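(* Let $p$ be a prime and $G$ a totally disconnected locally compact (t.d.l.c.) group. Then $G$ is normed $p$-adic amenable if and only if it is locally elliptic and $p^\mathbb{N}$-free. In this case, $$\|G\|_p = \min\{p^k \geq 1 \mid G \text{ is } p^{k+1}\text{-free}\} = \max\{p^k \mid \text{there exist open subgroups } V \leq U \leq G \text{ with } p^k \mid [U:V]\}.$$
   Context: $C_b(G,\mathbb{Q}_p)$ is the space of continuous bounded functions $G\to\mathbb{Q}_p$ with sup norm (using the $p$-adic norm $|\cdot|_p$), with $G$ acting by $(g\cdot f)(x)=f(g^{-1}x)$. A normed $\mathbb{Q}_p$-mean on $G$ is a bounded linear map $m:C_b(G,\mathbb{Q}_p)\to\mathbb{Q}_p$ with $m(\mathbbm{1}_G)=1$; it is left-invariant if $m(g\cdot f)=m(f)$. $G$ is normed $p$-adic amenable if it admits a left-invariant normed $\mathbb{Q}_p$-mean, and $\|G\|_p$ is the infimum of the operator norms $\|m\|_{op}=\inf\{C\ge0:|m(f)|_p\le C\|f\|_\infty\ \forall f\}$ of such means ($\|G\|_p=\infty$ if none exists). $G$ is locally elliptic if every finite subset of $G$ is contained in a compact subgroup (equivalently, $G$ is a directed union of compact open subgroups). For an integer $n$, $G$ is $n$-free if for every pair of open subgroups $V\le U\le G$ with $[U:V]$ finite, $n$ does not divide $[U:V]$. $G$ is $p^\mathbb{N}$-free if it is $p^k$-free for some $k\ge1$. *)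

theory Defs
  imports "HOL-Analysis.Analysis" "HOL-Algebra.Algebra" "HOL-Computational_Algebra.Primes"
begin

definition padic_abs_rat :: "nat \<Rightarrow> rat \<Rightarrow> real" where
  "padic_abs_rat p q =
     (if q = 0 then 0
      else (let (a, b) = quotient_of q in
            real p powr (real (multiplicity (int p) b) - real (multiplicity (int p) a))))"

text \<open>(K, nv) is a model of Q_p: a complete non-archimedean valued field of characteristic 0
  whose absolute value restricts to the p-adic one on Q, and in which Q is dense.
  Such a valued field is unique up to isometric isomorphism (it is the completion of
  (Q, |.|_p)), so quantifying over all such (K, nv) is the same as speaking about Q_p.\<close>
definition is_Qp :: "nat \<Rightarrow> ('k::field_char_0 \<Rightarrow> real) \<Rightarrow> bool" where
  "is_Qp p nv \<longleftrightarrow>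
     (\<forall>x. nv x = 0 \<longleftrightarrow> x = 0) \<and>
     (\<forall>x. nv x \<ge> 0) \<and>
     (\<forall>x y. nv (x * y) = nv x * nv y) \<and>
     (\<forall>x y. nv (x + y) \<le> max (nv x) (nv y)) \<and>
     (\<forall>q. nv (of_rat q) = padic_abs_rat p q) \<and>
     (\<forall>x e. e > 0 \<longrightarrow> (\<exists>q. nv (x - of_rat q) < e)) \<and>
     (\<forall>(xs::nat \<Rightarrow> 'k). (\<forall>e>0. \<exists>N. \<forall>m\<ge>N. \<forall>n\<ge>N. nv (xs m - xs n) < e)
          \<longrightarrow> (\<exists>L. \<forall>e>0. \<exists>N. \<forall>n\<ge>N. nv (xs n - L) < e))"

definition nv_topology :: "('k::field \<Rightarrow> real) \<Rightarrow> 'k topology" where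
  "nv_topology nv = topology (\<lambda>U. \<forall>x\<in>U. \<exists>e>0. \<forall>y. nv (y - x) < e \<longrightarrow> y \<in> U)"

definition topological_group :: "('g, 'b) monoid_scheme \<Rightarrow> 'g topology \<Rightarrow> bool" where
  "topological_group G T \<longleftrightarrow> group G \<and> topspace T = carrier G \<and>
     continuous_map (prod_topology T T) T (\<lambda>(x, y). x \<otimes>\<^bsub>G\<^esub> y) \<and>
     continuous_map T T (\<lambda>x. inv\<^bsub>G\<^esub> x)"

definition totally_disconnected_space :: "'a topology \<Rightarrow> bool" where
  "totally_disconnected_space T \<longleftrightarrow>
     (\<forall>S. S \<subseteq> topspace T \<and> connectedin T S \<longrightarrow> (\<exists>a. S \<subseteq> {a}))"

definition tdlc_group :: "('g, 'b) monoid_scheme \<Rightarrow> 'g topology \<Rightarrow> bool" where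
  "tdlc_group G T \<longleftrightarrow> topological_group G T \<and> Hausdorff_space T \<and>
     locally_compact_space T \<and> totally_disconnected_space T"

definition locally_elliptic :: "('g, 'b) monoid_scheme \<Rightarrow> 'g topology \<Rightarrow> bool" where
  "locally_elliptic G T \<longleftrightarrow>
     (\<forall>F. finite F \<and> F \<subseteq> carrier G \<longrightarrow> (\<exists>K. subgroup K G \<and> compactin T K \<and> F \<subseteq> K))"

definition open_subgroup :: "('g, 'b) monoid_scheme \<Rightarrow> 'g topology \<Rightarrow> 'g set \<Rightarrow> bool" where
  "open_subgroup G T H \<longleftrightarrow> subgroup H G \<and> openin T H"

definition cosets_in :: "('g, 'b) monoid_scheme \<Rightarrow> 'g set \<Rightarrow> 'g set \<Rightarrow> 'g set set" where
  "cosets_in G U V = {V #>\<^bsub>G\<^esub> u | u. u \<in> U}"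

definition index :: "('g, 'b) monoid_scheme \<Rightarrow> 'g set \<Rightarrow> 'g set \<Rightarrow> nat" where
  "index G U V = card (cosets_in G U V)"

definition n_free :: "('g, 'b) monoid_scheme \<Rightarrow> 'g topology \<Rightarrow> nat \<Rightarrow> bool" where
  "n_free G T n \<longleftrightarrow>
     (\<forall>U V. open_subgroup G T U \<and> open_subgroup G T V \<and> V \<subseteq> U \<and> finite (cosets_in G U V)
        \<longrightarrow> \<not> n dvd index G U V)"

definition pN_free :: "('g, 'b) monoid_scheme \<Rightarrow> 'g topology \<Rightarrow> nat \<Rightarrow> bool" where
  "pN_free G T p \<longleftrightarrow> (\<exists>k\<ge>1. n_free G T (p ^ k))"

definition Cb :: "('g, 'b) monoid_scheme \<Rightarrow> 'g topology \<Rightarrow> ('k::field \<Rightarrow> real) \<Rightarrow> ('g \<Rightarrow> 'k) set" where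
  "Cb G T nv = {f. continuous_map T (nv_topology nv) f \<and>
                  (\<exists>B. \<forall>x\<in>carrier G. nv (f x) \<le> B) \<and>
                  (\<forall>x. x \<notin> carrier G \<longrightarrow> f x = 0)}"

definition sup_norm :: "('g, 'b) monoid_scheme \<Rightarrow> ('k \<Rightarrow> real) \<Rightarrow> ('g \<Rightarrow> 'k) \<Rightarrow> real" where
  "sup_norm G nv f = (SUP x\<in>carrier G. nv (f x))"

definition one_G :: "('g, 'b) monoid_scheme \<Rightarrow> 'g \<Rightarrow> 'k::field" where
  "one_G G = (\<lambda>x. if x \<in> carrier G then 1 else 0)"

definition translate :: "('g, 'b) monoid_scheme \<Rightarrow> 'g \<Rightarrow> ('g \<Rightarrow> 'k::field) \<Rightarrow> 'g \<Rightarrow> 'k" where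
  "translate G g f = (\<lambda>x. if x \<in> carrier G then f (inv\<^bsub>G\<^esub> g \<otimes>\<^bsub>G\<^esub> x) else 0)"

definition normed_mean ::
  "('g, 'b) monoid_scheme \<Rightarrow> 'g topology \<Rightarrow> ('k::field \<Rightarrow> real) \<Rightarrow> (('g \<Rightarrow> 'k) \<Rightarrow> 'k) \<Rightarrow> bool" where
  "normed_mean G T nv m \<longleftrightarrow>
     (\<forall>f\<in>Cb G T nv. \<forall>h\<in>Cb G T nv. m (\<lambda>x. f x + h x) = m f + m h) \<and>
     (\<forall>c. \<forall>f\<in>Cb G T nv. m (\<lambda>x. c * f x) = c * m f) \<and>
     (\<exists>C\<ge>0. \<forall>f\<in>Cb G T nv. nv (m f) \<le> C * sup_norm G nv f) \<and>
     m (one_G G) = 1"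

definition left_invariant ::
  "('g, 'b) monoid_scheme \<Rightarrow> 'g topology \<Rightarrow> ('k::field \<Rightarrow> real) \<Rightarrow> (('g \<Rightarrow> 'k) \<Rightarrow> 'k) \<Rightarrow> bool" where
  "left_invariant G T nv m \<longleftrightarrow>
     (\<forall>g\<in>carrier G. \<forall>f\<in>Cb G T nv. m (translate G g f) = m f)"

definition op_norm ::
  "('g, 'b) monoid_scheme \<Rightarrow> 'g topology \<Rightarrow> ('k::field \<Rightarrow> real) \<Rightarrow> (('g \<Rightarrow> 'k) \<Rightarrow> 'k) \<Rightarrow> real" where
  "op_norm G T nv m = Inf {C. C \<ge> 0 \<and> (\<forall>f\<in>Cb G T nv. nv (m f) \<le> C * sup_norm G nv f)}"

definition normed_padic_amenable ::
  "('g, 'b) monoid_scheme \<Rightarrow> 'g topology \<Rightarrow> ('k::field \<Rightarrow> real) \<Rightarrow> bool" where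
  "normed_padic_amenable G T nv \<longleftrightarrow>
     (\<exists>m. normed_mean G T nv m \<and> left_invariant G T nv m)"

definition padic_norm_group ::
  "('g, 'b) monoid_scheme \<Rightarrow> 'g topology \<Rightarrow> ('k::field \<Rightarrow> real) \<Rightarrow> ereal" where
  "padic_norm_group G T nv =
     (if normed_padic_amenable G T nv
      then ereal (Inf {op_norm G T nv m | m. normed_mean G T nv m \<and> left_invariant G T nv m})
      else \<infinity>)"

end

theory Submission
  imports Defs "HOL-Number_Theory.Cong"
begin

text \<open>
  Suppose an invariant mean \<open>m\<close> of norm at most \<open>C\<close> is given.

  \<^item> For open subgroups \<open>V \<le> U\<close> of finite index \<open>n\<close> and a set \<open>R\<close> of representatives of
    \<open>U \ G\<close>, the group is the disjoint union of \<open>n\<close> translates of \<open>V R\<close>, so the indicator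
    function of \<open>V R\<close> has mean \<open>1/n\<close>. Hence \<open>p\<^sup>k\<close> dividing \<open>n\<close> forces \<open>C \<ge> p\<^sup>k\<close>.

  \<^item> Let \<open>V\<close> be a compact open subgroup. If a finite set \<open>F\<close> lies in no compact subgroup, then
    \<open>F\<close> preserves no finite nonempty subset of \<open>G/V\<close>. On every finite part of \<open>G/V\<close> any
    integer-valued function is then the divergence of an integral flow along the edges given by
    \<open>F\<close> (push the mass out of the finite part), and by compactness it is a divergence modulo \<open>p\<close>
    on all of \<open>G/V\<close>. Integral flows are bounded for the p-adic norm, so invariance gives
    \<open>m(\<phi>) = p m(\<phi>')\<close> with \<open>\<phi>'\<close> again integer-valued. Iterating from \<open>\<phi> = 1\<close> contradicts
    boundedness of \<open>m\<close>.

  Conversely, let \<open>G\<close> be locally elliptic and \<open>p\<^sup>k\<^sup>+\<^sup>1\<close>-free. The averages over \<open>U/V\<close>, for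
  \<open>V \<le> U\<close> compact open, have norm at most \<open>p\<^sup>k\<close> and are almost invariant under \<open>U\<close> on functions
  that vary little along cosets of \<open>V\<close>. Balls of the p-adic field are compact, so Tychonoff's
  theorem yields an invariant mean of norm at most \<open>p\<^sup>k\<close>.
\<close>

section \<open>The field of p-adic numbers\<close>

locale Qp_model =
  fixes p :: nat and nv :: "'k::field_char_0 \<Rightarrow> real"
  assumes prime_p: "Factorial_Ring.prime p" and Qp: "is_Qp p nv"
begin

lemma nv_zero_iff [simp]: "nv x = 0 \<longleftrightarrow> x = 0"
  and nv_nonneg [simp]: "nv x \<ge> 0"
  and nv_mult: "nv (x * y) = nv x * nv y"
  and nv_add: "nv (x + y) \<le> max (nv x) (nv y)"
  and nv_of_rat: "nv (of_rat q) = padic_abs_rat p q"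
  using Qp by (simp_all add: is_Qp_def)

lemma nv_zero [simp]: "nv 0 = 0"
  by simp

lemma rat_dense: "e > 0 \<Longrightarrow> \<exists>q. nv (x - of_rat q) < e"
  using Qp by (simp add: is_Qp_def)

lemma complete:
  fixes xs :: "nat \<Rightarrow> 'k"
  assumes "\<And>e. e > 0 \<Longrightarrow> \<exists>N. \<forall>m\<ge>N. \<forall>n\<ge>N. nv (xs m - xs n) < e"
  shows "\<exists>L. \<forall>e>0. \<exists>N. \<forall>n\<ge>N. nv (xs n - L) < e"
  using Qp assms by (simp add: is_Qp_def)

lemma p_gt_1: "real p > 1" "p > 1"
  using prime_gt_1_nat[OF prime_p] by auto

lemma nv_one [simp]: "nv 1 = 1"
  using nv_mult[of 1 1] nv_zero_iff[of 1] by simp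

lemma nv_minus [simp]: "nv (- x) = nv x"
proof -
  have "nv (-1) * nv (-1) = 1"
    using nv_mult[of "-1" "-1"] by simp
  then have "nv (-1) = 1"
    using nv_nonneg[of "-1"] by (metis abs_of_nonneg abs_mult_self_eq power2_eq_1_iff power2_eq_square real_sqrt_abs2 real_sqrt_one)
  then show ?thesis using nv_mult[of "-1" x] by simp
qed

lemma nv_diff: "nv (x - y) \<le> max (nv x) (nv y)"
  using nv_add[of x "- y"] by simp

lemma nv_diff_commute: "nv (x - y) = nv (y - x)"
  using nv_minus[of "x - y"] by simp

lemma nv_diff_triangle: "nv (x - z) \<le> max (nv (x - y)) (nv (y - z))"
  using nv_add[of "x - y" "y - z"] by simp

lemma nv_power: "nv (x ^ n) = nv x ^ n"
  by (induction n) (auto simp: nv_mult)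

lemma nv_inverse: "nv (inverse x) = inverse (nv x)"
proof (cases "x = 0")
  case False
  then have "nv x * nv (inverse x) = 1"
    using nv_mult[of x "inverse x"] by simp
  then show ?thesis
    by (metis inverse_unique)
qed simp

lemma nv_divide: "nv (x / y) = nv x / nv y"
  by (simp add: divide_inverse nv_mult nv_inverse)

lemma nv_sum_le: "finite A \<Longrightarrow> B \<ge> 0 \<Longrightarrow> (\<And>a. a \<in> A \<Longrightarrow> nv (f a) \<le> B) \<Longrightarrow> nv (sum f A) \<le> B"
proof (induction A rule: finite_induct)
  case (insert a A)
  then show ?case using nv_add[of "f a" "sum f A"] by fastforce
qed simp

section \<open>Absolute values of integers and approximation of the unit ball by integers\<close>

lemma nv_of_int: "n \<noteq> 0 \<Longrightarrow> nv (of_int n) = 1 / real p ^ multiplicity (int p) n"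
proof -
  assume "n \<noteq> 0"
  have "nv (of_int n) = nv (of_rat (of_int n))" by simp
  also have "\<dots> = real p powr (- real (multiplicity (int p) n))"
    using \<open>n \<noteq> 0\<close> unfolding nv_of_rat padic_abs_rat_def by simp
  also have "\<dots> = 1 / real p ^ multiplicity (int p) n"
    using p_gt_1 by (simp add: powr_minus powr_realpow divide_inverse)
  finally show ?thesis .
qed

lemma nv_of_int_le_1: "nv (of_int n) \<le> 1"
proof (cases "n = 0")
  case True
  then show ?thesis by simp
next
  case False
  then show ?thesis using p_gt_1 by (simp add: nv_of_int divide_le_eq_1)
qed

lemma nv_p: "nv (of_nat p) = 1 / real p"
proof -
  have "multiplicity (int p) (int p) = 1"
    using prime_p by (intro multiplicity_self) auto
  then show ?thesis
    using nv_of_int[of "int p"] p_gt_1 by simp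
qed

lemma nv_of_nat_le_if_dvd:
  assumes "p ^ k dvd n"
  shows "nv (of_nat n) \<le> 1 / real p ^ k"
proof -
  obtain m where "n = p ^ k * m" using assms by blast
  then have "nv (of_nat n) = (1 / real p) ^ k * nv (of_int (int m))"
    by (simp add: nv_mult nv_power nv_p)
  also have "\<dots> \<le> (1 / real p) ^ k * 1"
    by (intro mult_left_mono nv_of_int_le_1) auto
  finally show ?thesis by (simp add: power_one_over)
qed

text \<open>This is how freeness enters the construction of a mean: an index not divisible by
  \<open>p ^ Suc k\<close> is so large p-adically that dividing by it enlarges absolute values by at
  most \<open>p ^ k\<close>.\<close>

lemma nv_of_nat_ge_if_not_dvd:
  assumes "\<not> p ^ Suc k dvd n"
  shows "nv (of_nat n) \<ge> 1 / real p ^ k"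
proof -
  have n: "n \<noteq> 0" using assms by (intro notI) simp
  have "\<not> int p ^ Suc k dvd int n"
    using assms by (metis int_dvd_int_iff of_nat_power)
  then have "multiplicity (int p) (int n) \<le> k"
    by (metis multiplicity_dvd' not_less_eq_eq)
  then have "real p ^ multiplicity (int p) (int n) \<le> real p ^ k"
    using p_gt_1 by (intro power_increasing) auto
  then show ?thesis
    using nv_of_int[of "int n"] n p_gt_1 by (simp add: frac_le)
qed

lemma nv_of_int_le_if_dvd:
  assumes "int p ^ k dvd n"
  shows "nv (of_int n) \<le> 1 / real p ^ k"
proof -
  have "p ^ k dvd nat \<bar>n\<bar>"
    using assms by (metis nat_dvd_iff dvd_abs_iff int_dvd_int_iff of_nat_power abs_ge_zero nat_0_le)
  then have "nv (of_nat (nat \<bar>n\<bar>)) \<le> 1 / real p ^ k"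
    by (rule nv_of_nat_le_if_dvd)
  moreover have "of_nat (nat \<bar>n\<bar>) = (of_int \<bar>n\<bar> :: 'k)" by simp
  moreover have "nv (of_int \<bar>n\<bar>) = nv (of_int n)"
    by (cases "n \<ge> 0") auto
  ultimately show ?thesis by simp
qed

text \<open>A rational number close to \<open>x\<close> also lies in the unit ball, so its reduced
  denominator is prime to \<open>p\<close> and can be inverted modulo \<open>p ^ n\<close>. That the
  approximating integers come from a finite range is what makes balls totally bounded.\<close>

lemma integer_approx:
  assumes "nv x \<le> 1"
  shows "\<exists>a\<in>{0..<int p ^ n}. nv (x - of_int a) \<le> 1 / real p ^ n"
proof -
  obtain q where q: "nv (x - of_rat q) < 1 / real p ^ n"
    using rat_dense[of "1 / real p ^ n" x] p_gt_1 by auto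
  have "1 / real p ^ n \<le> 1" using p_gt_1 by (simp add: divide_le_eq_1)
  then have q1: "nv (of_rat q) \<le> 1"
    using nv_diff[of x "x - of_rat q"] q assms by simp
  obtain a b where ab: "quotient_of q = (a, b)" by fastforce
  have b: "b > 0" "coprime a b" "q = of_int a / of_int b"
    using ab quotient_of_denom_pos quotient_of_coprime quotient_of_div by auto
  have qab: "(of_rat q :: 'k) = of_int a / of_int b"
    using b(3) by (simp add: of_rat_divide)
  \<comment> \<open>The fraction is in lowest terms, so if \<open>p\<close> divided
    \<open>b\<close>, then \<open>a\<close> would be a unit and the fraction would have absolute
    value above 1.\<close>
  have "coprime b (int p)"
  proof (rule ccontr)
    assume "\<not> coprime b (int p)"
    then have pb: "int p dvd b"
      using prime_p by (metis coprime_commute prime_imp_coprime prime_nat_int_transfer)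
    then have "\<not> int p dvd a"
      using b(2) p_gt_1 by (metis coprime_common_divisor zdvd1_eq abs_of_nat of_nat_1_eq_iff less_irrefl)
    then have "nv (of_int a) = 1"
      using nv_of_int[of a] by (cases "a = 0") (auto simp: not_dvd_imp_multiplicity_0)
    moreover have "nv (of_int b) \<le> 1 / real p"
      using nv_of_int_le_if_dvd[of 1 b] pb by simp
    then have "nv (of_int b) < 1" using p_gt_1 by (smt (verit) divide_less_eq_1_pos)
    moreover have "nv (of_int b) > 0" using b(1) nv_nonneg nv_zero_iff
      by (metis less_eq_real_def less_irrefl of_int_eq_0_iff)
    ultimately have "nv (of_rat q) > 1"
      unfolding qab nv_divide by simp
    then show False using q1 by simp
  qed
  then have "coprime b (int p ^ n)" by simp
  then obtain c where c: "[b * c = 1] (mod int p ^ n)"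
    using cong_solve_coprime_int by blast
  have nvb: "nv (of_int b) = 1"
  proof -
    have "\<not> int p dvd b" using \<open>coprime b (int p)\<close> p_gt_1
      by (metis coprime_common_divisor dvd_refl zdvd1_eq abs_of_nat of_nat_1_eq_iff less_irrefl)
    then show ?thesis using nv_of_int[of b] b(1) by (simp add: not_dvd_imp_multiplicity_0)
  qed
  \<comment> \<open>\<open>c\<close> is an inverse of \<open>b\<close> modulo \<open>p ^ n\<close>,
    so \<open>a * c\<close> stands for \<open>a / b\<close>; reduction moves it into the finite
    range.\<close>
  define r where "r = (a * c) mod int p ^ n"
  have "int p ^ n dvd a - b * r"
  proof -
    have "[b * r = b * (a * c)] (mod int p ^ n)"
      unfolding r_def by (intro cong_mult) (auto simp: cong_def)
    also have "[b * (a * c) = a * (b * c)] (mod int p ^ n)" by (simp add: ac_simps)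
    also have "[a * (b * c) = a * 1] (mod int p ^ n)" using c by (intro cong_mult) auto
    finally show ?thesis by (metis cong_iff_dvd_diff cong_sym mult.right_neutral)
  qed
  then have "nv (of_int (a - b * r)) \<le> 1 / real p ^ n" by (rule nv_of_int_le_if_dvd)
  moreover have "of_rat q - of_int r = (of_int (a - b * r) / of_int b :: 'k)"
    using b(1) unfolding qab by (simp add: field_simps)
  ultimately have "nv (of_rat q - of_int r) \<le> 1 / real p ^ n"
    by (simp add: nv_divide nvb)
  then have "nv (x - of_int r) \<le> 1 / real p ^ n"
    using nv_diff_triangle[of x "of_int r" "of_rat q"] q by linarith
  moreover have "r \<in> {0..<int p ^ n}" using p_gt_1 by (simp add: r_def)
  ultimately show ?thesis by blast
qed

section \<open>The metric topology and compactness of balls\<close>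

sublocale K: Metric_space UNIV "\<lambda>x y. nv (x - y)"
proof
  fix x y z :: 'k
  show "nv (x - z) \<le> nv (x - y) + nv (y - z)"
    using nv_diff_triangle[of x z y] nv_nonneg[of "x - y"] nv_nonneg[of "y - z"] by linarith
qed (auto simp: nv_diff_commute)

lemma openin_nv_topology:
  "openin (nv_topology nv) U \<longleftrightarrow> (\<forall>x\<in>U. \<exists>e>0. \<forall>y. nv (y - x) < e \<longrightarrow> y \<in> U)"
proof -
  have "istopology (\<lambda>U. \<forall>x\<in>U. \<exists>e>0. \<forall>y. nv (y - x) < e \<longrightarrow> y \<in> U)"
    unfolding istopology_def
  proof (intro conjI allI impI ballI, goal_cases)
    case (1 S T x)
    then obtain d e where "d > 0" "e > 0" "\<forall>y. nv (y - x) < d \<longrightarrow> y \<in> S" "\<forall>y. nv (y - x) < e \<longrightarrow> y \<in> T"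
      by blast
    then show ?case by (intro exI[of _ "min d e"]) auto
  next
    case (2 \<K> x)
    then show ?case by (metis UnionE UnionI)
  qed
  then show ?thesis by (simp add: nv_topology_def topology_inverse')
qed

lemma nv_topology_eq: "nv_topology nv = K.mtopology"
  unfolding topology_eq openin_nv_topology K.openin_mtopology
  by (auto simp: subset_iff nv_diff_commute)

lemma topspace_nv_topology [simp]: "topspace (nv_topology nv) = UNIV"
  by (simp add: nv_topology_eq)

lemma K_mcomplete: "K.mcomplete"
  unfolding K.mcomplete_def
proof (intro allI impI)
  fix \<sigma> assume "K.MCauchy \<sigma>"
  then obtain L where "\<And>e. e > 0 \<Longrightarrow> \<exists>N. \<forall>n\<ge>N. nv (\<sigma> n - L) < e"
    using complete[of \<sigma>] unfolding K.MCauchy_def by metis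
  then show "\<exists>x. limitin K.mtopology \<sigma> x sequentially"
    unfolding K.limitin_metric eventually_sequentially by auto
qed

text \<open>Multiplication by a power of \<open>p\<close> moves the ball into the unit ball, where
  \<open>integer_approx\<close> provides finite nets; completeness turns total boundedness into
  compactness. Tychonoff's theorem is later applied to products of these balls.\<close>

lemma compactin_cball: "compactin (nv_topology nv) {x. nv x \<le> R}"
proof -
  obtain j where j: "R < real p ^ j"
    using p_gt_1(1) real_arch_pow by blast
  define S where "S = {x. nv x \<le> real p ^ j}"
  have "K.mtotally_bounded S"
    unfolding K.mtotally_bounded_def
  proof (intro allI impI)
    fix e :: real assume e: "e > 0"
    obtain n where n: "1 / e < real p ^ n"
      using p_gt_1(1) real_arch_pow by blast
    then have n': "1 / real p ^ n < e" using e p_gt_1 by (simp add: field_simps)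
    \<comment> \<open>Undoing the scaling costs a factor \<open>p ^ j\<close>, so the scaled point
      has to be approximated to order \<open>n + j\<close>.\<close>
    define C where "C = (\<lambda>a. of_int a / of_nat p ^ j :: 'k) ` {0..<int p ^ (n + j)}"
    have "C \<subseteq> S"
      using p_gt_1 nv_of_int_le_1 by (auto simp: C_def S_def nv_divide nv_power nv_p power_one_over)
    moreover have "S \<subseteq> (\<Union>x\<in>C. K.mball x e)"
    proof
      fix x assume "x \<in> S"
      then have "nv (x * of_nat p ^ j) \<le> 1"
        using p_gt_1 by (simp add: S_def nv_mult nv_power nv_p power_one_over field_simps)
      then obtain a where a: "a \<in> {0..<int p ^ (n + j)}" "nv (x * of_nat p ^ j - of_int a) \<le> 1 / real p ^ (n + j)"
        using integer_approx by blast
      have "of_int a / of_nat p ^ j - x = (of_int a - x * of_nat p ^ j) / of_nat p ^ j"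
        using p_gt_1 by (simp add: field_simps)
      then have "nv (of_int a / of_nat p ^ j - x) = nv (x * of_nat p ^ j - of_int a) * real p ^ j"
        by (simp add: nv_divide nv_power nv_p power_one_over nv_diff_commute)
      also have "\<dots> \<le> 1 / real p ^ (n + j) * real p ^ j"
        using a(2) by (intro mult_right_mono) auto
      also have "\<dots> < e" using n' p_gt_1 by (simp add: power_add)
      finally show "x \<in> (\<Union>x\<in>C. K.mball x e)"
        using a(1) unfolding C_def by auto
    qed
    ultimately show "\<exists>K. finite K \<and> K \<subseteq> S \<and> S \<subseteq> (\<Union>x\<in>K. K.mball x e)"
      by (intro exI[of _ C]) (auto simp: C_def)
  qed
  then have "compactin K.mtopology (K.mtopology closure_of S)"
    by (simp add: K.mtotally_bounded_eq_compact_closure_of[OF K_mcomplete])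
  moreover have "closedin K.mtopology {x. nv x \<le> R}" for R
    using K.closedin_mcball[of 0 R] by (simp add: K.mcball_def)
  moreover have "{x. nv x \<le> R} \<subseteq> K.mtopology closure_of S"
    using j closure_of_subset[of S K.mtopology] by (auto simp: S_def)
  ultimately show ?thesis
    unfolding nv_topology_eq by (metis closed_compactin)
qed

section \<open>Continuous functions with p-adic values\<close>

lemma continuous_map_nv_iff:
  "continuous_map Y (nv_topology nv) f \<longleftrightarrow>
   (\<forall>x\<in>topspace Y. \<forall>e>0. \<exists>U. openin Y U \<and> x \<in> U \<and> (\<forall>y\<in>U. nv (f y - f x) < e))"
  unfolding nv_topology_eq K.continuous_map_to_metric
  by (auto simp: nv_diff_commute Bex_def)

lemma continuous_map_nv_add:
  assumes "continuous_map Y (nv_topology nv) f" "continuous_map Y (nv_topology nv) g"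
  shows "continuous_map Y (nv_topology nv) (\<lambda>x. f x + g x)"
  unfolding continuous_map_nv_iff
proof (intro ballI allI impI)
  fix x e assume x: "x \<in> topspace Y" and e: "(e::real) > 0"
  obtain U V where U: "openin Y U" "x \<in> U" "\<And>y. y\<in>U \<Longrightarrow> nv (f y - f x) < e"
    and V: "openin Y V" "x \<in> V" "\<And>y. y\<in>V \<Longrightarrow> nv (g y - g x) < e"
    using assms x e unfolding continuous_map_nv_iff by metis
  have "nv (f y + g y - (f x + g x)) < e" if "y \<in> U \<inter> V" for y
    using U(3)[of y] V(3)[of y] that nv_add[of "f y - f x" "g y - g x"] by (simp add: add_diff_add)
  then show "\<exists>U. openin Y U \<and> x \<in> U \<and> (\<forall>y\<in>U. nv (f y + g y - (f x + g x)) < e)"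
    using U V by (intro exI[of _ "U \<inter> V"]) auto
qed

lemma continuous_map_nv_cmult:
  assumes "continuous_map Y (nv_topology nv) f"
  shows "continuous_map Y (nv_topology nv) (\<lambda>x. c * f x)"
proof (cases "c = 0")
  case False
  then have c: "nv c > 0" using nv_nonneg[of c] nv_zero_iff[of c] by linarith
  show ?thesis
    unfolding continuous_map_nv_iff
  proof (intro ballI allI impI)
    fix x e assume x: "x \<in> topspace Y" and e: "(e::real) > 0"
    then obtain U where U: "openin Y U" "x \<in> U" "\<And>y. y\<in>U \<Longrightarrow> nv (f y - f x) < e / nv c"
      using assms c unfolding continuous_map_nv_iff by (metis divide_pos_pos)
    have "nv (c * f y - c * f x) < e" if "y \<in> U" for y
      using U(3)[OF that] c
      by (simp only: nv_mult pos_less_divide_eq mult.commute flip: right_diff_distrib)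
    then show "\<exists>U. openin Y U \<and> x \<in> U \<and> (\<forall>y\<in>U. nv (c * f y - c * f x) < e)"
      using U by blast
  qed
qed simp

lemma continuous_map_nv_diff:
  assumes "continuous_map Y (nv_topology nv) f" "continuous_map Y (nv_topology nv) g"
  shows "continuous_map Y (nv_topology nv) (\<lambda>x. f x - g x)"
  using continuous_map_nv_add[OF assms(1) continuous_map_nv_cmult[OF assms(2), of "-1"]] by simp

text \<open>With \<open>B = 0\<close> and \<open>f\<close> a difference of two sides, this shows
  that an identity between continuous functions is a closed condition.\<close>

lemma closedin_nv_le:
  assumes "continuous_map Y (nv_topology nv) f"
  shows "closedin Y {x \<in> topspace Y. nv (f x) \<le> B}"
  using closedin_continuous_map_preimage[OF assms, of "{y. nv y \<le> B}"] K.closedin_mcball[of 0 B]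
  by (simp add: K.mcball_def nv_topology_eq)

end

section \<open>Compact open subgroups\<close>

locale tdlc =
  fixes G :: "('g, 'b) monoid_scheme" (structure) and T :: "'g topology"
  assumes tdlc: "tdlc_group G T"
begin

sublocale group G
  using tdlc by (simp add: tdlc_group_def topological_group_def)

lemma topspace_T: "topspace T = carrier G"
  and continuous_mult: "continuous_map (prod_topology T T) T (\<lambda>(x, y). x \<otimes> y)"
  and continuous_inv: "continuous_map T T (\<lambda>x. inv x)"
  and Hausdorff: "Hausdorff_space T"
  and locally_compact: "locally_compact_space T"
  and totally_disconnected: "totally_disconnected_space T"
  using tdlc by (auto simp: tdlc_group_def topological_group_def)

section \<open>Translations, cosets and open subgroups\<close>

lemma continuous_mult_left: "a \<in> carrier G \<Longrightarrow> continuous_map T T (\<lambda>x. a \<otimes> x)"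
  using continuous_map_compose[OF _ continuous_mult, of T "\<lambda>x. (a, x)"]
  by (simp add: o_def continuous_map_pairwise topspace_T)

lemma continuous_mult_right: "a \<in> carrier G \<Longrightarrow> continuous_map T T (\<lambda>x. x \<otimes> a)"
  using continuous_map_compose[OF _ continuous_mult, of T "\<lambda>x. (x, a)"]
  by (simp add: o_def continuous_map_pairwise topspace_T)

lemma mem_l_coset_iff:
  assumes "a \<in> carrier G" "W \<subseteq> carrier G" "x \<in> carrier G"
  shows "x \<in> a <# W \<longleftrightarrow> inv a \<otimes> x \<in> W"
proof
  assume "x \<in> a <# W"
  then show "inv a \<otimes> x \<in> W"
    using assms by (auto simp: l_coset_def subset_iff inv_solve_left' m_assoc[symmetric])
next
  assume "inv a \<otimes> x \<in> W"
  moreover have "x = a \<otimes> (inv a \<otimes> x)" using assms by (simp add: m_assoc[symmetric])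
  ultimately show "x \<in> a <# W" by (auto simp: l_coset_def)
qed

lemma mem_r_coset_iff:
  assumes "a \<in> carrier G" "W \<subseteq> carrier G" "x \<in> carrier G"
  shows "x \<in> W #> a \<longleftrightarrow> x \<otimes> inv a \<in> W"
proof
  assume "x \<in> W #> a"
  then show "x \<otimes> inv a \<in> W"
    using assms by (auto simp: r_coset_def subset_iff m_assoc)
next
  assume "x \<otimes> inv a \<in> W"
  moreover have "x = (x \<otimes> inv a) \<otimes> a" using assms by (simp add: m_assoc)
  ultimately show "x \<in> W #> a" by (auto simp: r_coset_def)
qed

lemma openin_subset_carrier: "openin T W \<Longrightarrow> W \<subseteq> carrier G"
  using openin_subset topspace_T by metis

lemma compactin_subset_carrier: "compactin T W \<Longrightarrow> W \<subseteq> carrier G"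
  using compactin_subset_topspace topspace_T by metis

lemma openin_l_coset:
  assumes "openin T W" "a \<in> carrier G"
  shows "openin T (a <# W)"
proof -
  have "a <# W = {x \<in> topspace T. inv a \<otimes> x \<in> W}"
    using l_coset_subset_G[OF openin_subset_carrier[OF assms(1)] assms(2)]
      mem_l_coset_iff[OF assms(2) openin_subset_carrier[OF assms(1)]]
    by (auto simp: topspace_T)
  then show ?thesis
    using openin_continuous_map_preimage[OF continuous_mult_left[of "inv a"] assms(1)] assms(2) by simp
qed

lemma openin_r_coset:
  assumes "openin T W" "a \<in> carrier G"
  shows "openin T (W #> a)"
proof -
  have "W #> a = {x \<in> topspace T. x \<otimes> inv a \<in> W}"
    using r_coset_subset_G[OF openin_subset_carrier[OF assms(1)] assms(2)]
      mem_r_coset_iff[OF assms(2) openin_subset_carrier[OF assms(1)]]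
    by (auto simp: topspace_T)
  then show ?thesis
    using openin_continuous_map_preimage[OF continuous_mult_right[of "inv a"] assms(1)] assms(2) by simp
qed

lemma compactin_l_coset:
  assumes "compactin T W" "a \<in> carrier G"
  shows "compactin T (a <# W)"
proof -
  have "a <# W = (\<lambda>x. a \<otimes> x) ` W" by (auto simp: l_coset_def)
  then show ?thesis using image_compactin[OF assms(1) continuous_mult_left] assms(2) by simp
qed

lemma compactin_r_coset:
  assumes "compactin T W" "a \<in> carrier G"
  shows "compactin T (W #> a)"
proof -
  have "W #> a = (\<lambda>x. x \<otimes> a) ` W" by (auto simp: r_coset_def)
  then show ?thesis using image_compactin[OF assms(1) continuous_mult_right] assms(2) by simp
qed

lemma subgroup_openI:
  assumes H: "subgroup H G" and N: "openin T N" "\<one> \<in> N" "N \<subseteq> H"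
  shows "openin T H"
proof (subst openin_subopen, intro ballI)
  fix h assume h: "h \<in> H"
  then have hG: "h \<in> carrier G" using H subgroup.subset by blast
  have "h \<otimes> \<one> \<in> h <# N" using N(2) by (force simp: l_coset_def)
  moreover have "h <# N \<subseteq> H"
    using N(3) h H by (auto simp: l_coset_def subset_iff subgroup.m_closed)
  ultimately show "\<exists>S. openin T S \<and> h \<in> S \<and> S \<subseteq> H"
    using openin_l_coset[OF N(1) hG] hG by auto
qed

lemma open_subgroup_carrier: "open_subgroup G T (carrier G)"
  using openin_topspace[of T] subgroup_self by (simp add: open_subgroup_def topspace_T)

text \<open>The complement is a union of left cosets of \<open>H\<close>, all of them open.\<close>

lemma open_subgroup_closed:
  assumes H: "open_subgroup G T H"
  shows "closedin T H"
proof -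
  have sg: "subgroup H G" and op: "openin T H" using H by (auto simp: open_subgroup_def)
  have HG: "H \<subseteq> carrier G" using sg subgroup.subset by blast
  have "openin T (topspace T - H)"
  proof (subst openin_subopen, intro ballI)
    fix x assume x: "x \<in> topspace T - H"
    then have xG: "x \<in> carrier G" by (simp add: topspace_T)
    have "x \<in> x <# H"
      using sg xG HG by (simp add: mem_l_coset_iff subgroup.one_closed)
    moreover have "x <# H \<subseteq> topspace T - H"
    proof
      fix y assume y: "y \<in> x <# H"
      then obtain h where h: "h \<in> H" "y = x \<otimes> h" by (auto simp: l_coset_def)
      have hG: "h \<in> carrier G" using h HG by blast
      have "y \<notin> H"
      proof
        assume "y \<in> H"
        then have "y \<otimes> inv h \<in> H" using h sg by (simp add: subgroup.m_closed subgroup.m_inv_closed)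
        moreover have "y \<otimes> inv h = x" using h xG hG by (simp add: m_assoc)
        ultimately show False using x by simp
      qed
      then show "y \<in> topspace T - H" using h xG hG by (simp add: topspace_T)
    qed
    ultimately show "\<exists>S. openin T S \<and> x \<in> S \<and> S \<subseteq> topspace T - H"
      using openin_l_coset[OF op xG] by blast
  qed
  then show ?thesis using HG by (simp add: closedin_def topspace_T)
qed

section \<open>Stabilizers of compact open sets and van Dantzig's theorem\<close>

definition set_stabilizer :: "'g set \<Rightarrow> 'g set" where
  "set_stabilizer W = {h \<in> carrier G. h <# W = W}"

lemma subgroup_set_stabilizer:
  assumes W: "W \<subseteq> carrier G"
  shows "subgroup (set_stabilizer W) G"
proof (rule subgroupI)
  show "set_stabilizer W \<noteq> {}"
    using W lcos_mult_one by (auto simp: set_stabilizer_def)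
  fix a assume a: "a \<in> set_stabilizer W"
  then have "inv a <# (a <# W) = W"
    using W by (subst lcos_m_assoc) (auto simp: set_stabilizer_def lcos_mult_one)
  then show "inv a \<in> set_stabilizer W" using a by (simp add: set_stabilizer_def)
  fix b assume b: "b \<in> set_stabilizer W"
  have "(a \<otimes> b) <# W = a <# (b <# W)"
    using a b W by (subst lcos_m_assoc) (auto simp: set_stabilizer_def)
  then show "a \<otimes> b \<in> set_stabilizer W" using a b by (simp add: set_stabilizer_def)
qed (auto simp: set_stabilizer_def)

text \<open>The tube lemma, applied to the compact set \<open>W\<close> inside the open set
  \<open>W\<close>, gives a neighbourhood of the identity that multiplies \<open>W\<close> into
  itself, so the stabilizer is open. It is also closed and contained in the compact set
  \<open>W #> inv w\<close> for any \<open>w\<close> in \<open>W\<close>. All compact open subgroups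
  below arise in this way.\<close>

proposition set_stabilizer_compact_open:
  assumes W: "compactin T W" "openin T W" "W \<noteq> {}"
  shows "open_subgroup G T (set_stabilizer W)" "compactin T (set_stabilizer W)"
proof -
  have WG: "W \<subseteq> carrier G" using W openin_subset_carrier by blast
  define M where "M = {z \<in> topspace (prod_topology T T). (\<lambda>(x, y). x \<otimes> y) z \<in> W}"
  have "openin (prod_topology T T) M"
    unfolding M_def by (rule openin_continuous_map_preimage[OF continuous_mult W(2)])
  moreover have "{\<one>} \<times> W \<subseteq> M" using WG by (auto simp: M_def topspace_T)
  ultimately obtain N V where N: "openin T N" "\<one> \<in> N" and V: "W \<subseteq> V" "N \<times> V \<subseteq> M"
    using tube_lemma_right[of T T M W \<one>] W(1) by (auto simp: topspace_T)
  have sub: "h <# W \<subseteq> W" if "h \<in> N" for h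
    using V that by (fastforce simp: l_coset_def M_def)
  \<comment> \<open>Elements of \<open>N\<close> only satisfy an inclusion; applying it to the
    inverse as well gives equality.\<close>
  define N' where "N' = N \<inter> {x \<in> topspace T. inv x \<in> N}"
  have "openin T N'"
    unfolding N'_def using N continuous_inv by (intro openin_Int openin_continuous_map_preimage) auto
  moreover have "\<one> \<in> N'" using N by (simp add: N'_def topspace_T)
  moreover have "N' \<subseteq> set_stabilizer W"
  proof
    fix h assume h: "h \<in> N'"
    then have hG: "h \<in> carrier G" by (simp add: N'_def topspace_T)
    have "inv h <# W \<subseteq> W" using h sub by (simp add: N'_def)
    then have "h <# (inv h <# W) \<subseteq> h <# W" by (auto simp: l_coset_def)
    then have "W \<subseteq> h <# W" using hG WG by (simp add: lcos_m_assoc lcos_mult_one)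
    moreover have "h <# W \<subseteq> W" using h sub by (simp add: N'_def)
    ultimately show "h \<in> set_stabilizer W" using hG by (auto simp: set_stabilizer_def)
  qed
  ultimately show op: "open_subgroup G T (set_stabilizer W)"
    using subgroup_set_stabilizer[OF WG] subgroup_openI by (auto simp: open_subgroup_def)
  obtain w where w: "w \<in> W" using W(3) by blast
  then have wG: "w \<in> carrier G" using WG by blast
  have "set_stabilizer W \<subseteq> W #> inv w"
  proof
    fix h assume h: "h \<in> set_stabilizer W"
    then have hG: "h \<in> carrier G" by (simp add: set_stabilizer_def)
    have "h \<otimes> w \<in> h <# W" using w by (auto simp: l_coset_def)
    then have "h \<otimes> w \<in> W" using h by (simp add: set_stabilizer_def)
    then show "h \<in> W #> inv w" using hG wG WG by (simp add: mem_r_coset_iff)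
  qed
  then show "compactin T (set_stabilizer W)"
    using closed_compactin[OF compactin_r_coset[OF W(1)] _ open_subgroup_closed[OF op], of "inv w"] wG
    by simp
qed

text \<open>The component of the identity is a point, so some compact open set \<open>W\<close>
  satisfies \<one> \<in> W \<subseteq> N. An element \<open>h\<close> of its stabilizer is
  \<open>h\<close> times the identity, hence lies in \<open>W\<close>.\<close>

theorem van_Dantzig:
  assumes N: "openin T N" "\<one> \<in> N"
  obtains V where "open_subgroup G T V" "compactin T V" "V \<subseteq> N"
proof -
  obtain U K where UK: "openin T U" "compactin T K" "\<one> \<in> U" "U \<subseteq> K"
    using locally_compact by (metis locally_compact_space_def one_closed topspace_T)
  have "connected_component_of_set T \<one> \<subseteq> {\<one>}"
  proof -
    obtain a where "connected_component_of_set T \<one> \<subseteq> {a}"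
      using totally_disconnected connectedin_connected_component_of[of T \<one>]
        connected_component_of_subset_topspace[of T \<one>]
      unfolding totally_disconnected_space_def by meson
    then show ?thesis
      by (metis connected_component_of_refl mem_Collect_eq one_closed singletonD subsetD topspace_T)
  qed
  then have "connected_component_of_set T \<one> = {\<one>}"
    by (auto simp: connected_component_of_refl topspace_T)
  then have "{\<one>} \<in> connected_components_of T"
    by (metis connected_component_in_connected_components_of one_closed topspace_T)
  \<comment> \<open>A compact component of a locally compact Hausdorff space has arbitrarily small
    clopen neighbourhoods. Staying inside \<open>U\<close>, hence inside \<open>K\<close>, makes
    \<open>W\<close> compact.\<close>
  then obtain W Z where WZ: "openin T W" "openin T Z" "disjnt W Z" "W \<union> Z = topspace T"
      "{\<one>} \<subseteq> W" "W \<subseteq> N \<inter> U"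
    using wilder_locally_compact_component_thm[OF locally_compact Hausdorff, of "{\<one>}" "N \<inter> U"]
      UK N by (metis IntI empty_subsetI finite.emptyI finite.insertI finite_imp_compactin insert_subset
        one_closed openin_Int topspace_T)
  have "topspace T - W = Z" using WZ openin_subset[OF WZ(2)] by (auto simp: disjnt_iff)
  then have "closedin T W"
    using WZ openin_subset[OF WZ(1)] by (simp add: closedin_def)
  then have cW: "compactin T W"
    using closed_compactin[OF UK(2)] WZ UK by blast
  have "set_stabilizer W \<subseteq> W"
  proof
    fix h assume h: "h \<in> set_stabilizer W"
    then have "h \<otimes> \<one> \<in> h <# W" using WZ(5) by (force simp: l_coset_def)
    then show "h \<in> W" using h by (simp add: set_stabilizer_def)
  qed
  then show ?thesis
    using that set_stabilizer_compact_open[OF cW WZ(1)] WZ by blast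
qed

text \<open>For a compact open subgroup \<open>V\<close>, the product set \<open>KV\<close> is
  compact, open and stable under left multiplication by \<open>K\<close>, so its stabilizer contains
  \<open>K\<close>. This passes from the compact subgroups in \<open>locally_elliptic\<close> to the
  open ones over which averages are taken.\<close>

lemma compact_subgroup_in_compact_open:
  assumes K: "subgroup K G" "compactin T K"
  obtains U where "open_subgroup G T U" "compactin T U" "K \<subseteq> U"
proof -
  obtain V where V: "open_subgroup G T V" "compactin T V"
    using van_Dantzig[of "topspace T"] by (metis one_closed openin_topspace topspace_T)
  define W where "W = (\<lambda>(x, y). x \<otimes> y) ` (K \<times> V)"
  have KG: "K \<subseteq> carrier G" and VG: "V \<subseteq> carrier G"
    using K V compactin_subset_carrier by auto
  have "compactin (prod_topology T T) (K \<times> V)"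
    using K V by (simp add: compactin_Times)
  then have "compactin T W"
    unfolding W_def using continuous_mult by (rule image_compactin)
  moreover have "W = (\<Union>k\<in>K. k <# V)"
    by (auto simp: W_def l_coset_def)
  then have "openin T W"
    using V KG by (auto intro!: openin_Union openin_l_coset simp: open_subgroup_def)
  moreover have "\<one> \<in> V" using V by (simp add: open_subgroup_def subgroup.one_closed)
  moreover have "\<one> \<in> K" using K by (simp add: subgroup.one_closed)
  ultimately have W: "compactin T W" "openin T W" "W \<noteq> {}" by (auto simp: W_def)
  have sub: "k <# W \<subseteq> W" if "k \<in> K" for k
  proof
    fix x assume "x \<in> k <# W"
    then obtain l v where lv: "l \<in> K" "v \<in> V" "x = k \<otimes> (l \<otimes> v)"
      by (auto simp: l_coset_def W_def)
    then have "x = (k \<otimes> l) \<otimes> v" using that KG VG by (simp add: m_assoc subset_iff)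
    moreover have "k \<otimes> l \<in> K" using that lv K by (simp add: subgroup.m_closed)
    ultimately show "x \<in> W" using lv by (auto simp: W_def)
  qed
  have "K \<subseteq> set_stabilizer W"
  proof
    fix k assume k: "k \<in> K"
    then have kG: "k \<in> carrier G" using KG by blast
    have "inv k <# W \<subseteq> W" using k sub K by (simp add: subgroup.m_inv_closed)
    then have "k <# (inv k <# W) \<subseteq> k <# W" by (auto simp: l_coset_def)
    then have "W \<subseteq> k <# W"
      using kG compactin_subset_carrier[OF W(1)] by (simp add: lcos_m_assoc lcos_mult_one)
    then show "k \<in> set_stabilizer W" using sub[OF k] kG by (auto simp: set_stabilizer_def)
  qed
  then show ?thesis
    using that set_stabilizer_compact_open[OF W] by blast
qed

text \<open>The cosets form an open cover of the compact set \<open>U\<close>. Distinct ones are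
  disjoint and each meets \<open>U\<close>, so a finite subcover already contains all of
  them.\<close>

lemma finite_cosets_in:
  assumes U: "subgroup U G" "compactin T U" and V: "open_subgroup G T V"
  shows "finite (cosets_in G U V)"
proof -
  have UG: "U \<subseteq> carrier G" using U compactin_subset_carrier by blast
  have V': "subgroup V G" "openin T V" using V by (auto simp: open_subgroup_def)
  have mem: "u \<in> V #> u" if "u \<in> U" for u using that UG V' rcos_self by blast
  have "\<And>c. c \<in> cosets_in G U V \<Longrightarrow> openin T c"
    using V' UG openin_r_coset by (auto simp: cosets_in_def)
  moreover have "U \<subseteq> \<Union>(cosets_in G U V)"
    using mem by (auto simp: cosets_in_def)
  ultimately obtain F where F: "finite F" "F \<subseteq> cosets_in G U V" "U \<subseteq> \<Union>F"
    using U(2) unfolding compactin_def by metis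
  have "cosets_in G U V \<subseteq> F"
  proof
    fix c assume "c \<in> cosets_in G U V"
    then obtain u where u: "u \<in> U" "c = V #> u" by (auto simp: cosets_in_def)
    then obtain d where d: "d \<in> F" "u \<in> d" using F by blast
    then obtain u' where u': "u' \<in> U" "d = V #> u'" using F by (auto simp: cosets_in_def)
    then have "V #> u' = V #> u"
      using d V' UG repr_independence[of u V u'] by blast
    then show "c \<in> F" using u u' d by simp
  qed
  then show ?thesis using F finite_subset by blast
qed

lemma open_subgroup_Int_finite:
  assumes "finite A" "open_subgroup G T U" "\<And>a. a \<in> A \<Longrightarrow> open_subgroup G T (V a)"
  shows "open_subgroup G T (U \<inter> (\<Inter>a\<in>A. V a))"
  using assms
proof (induction A rule: finite_induct)
  case (insert a A)
  have "U \<inter> (\<Inter>a\<in>insert a A. V a) = V a \<inter> (U \<inter> (\<Inter>a\<in>A. V a))" by blast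
  then show ?case
    using insert subgroups_Inter_pair by (simp add: open_subgroup_def openin_Int)
qed simp

definition coset_rep :: "'g set \<Rightarrow> 'g" where
  "coset_rep c = (SOME y. y \<in> c)"

lemma coset_rep:
  assumes sU: "subgroup U G" and sV: "subgroup V G" and "V \<subseteq> U" and c: "c \<in> cosets_in G U V"
  shows "coset_rep c \<in> U" "c = V #> coset_rep c"
proof -
  have UG: "U \<subseteq> carrier G" using sU subgroup.subset by blast
  obtain u where u: "u \<in> U" "c = V #> u" using c by (auto simp: cosets_in_def)
  then have "u \<in> c" using rcos_self[OF _ sV] UG by blast
  then have rc: "coset_rep c \<in> c" unfolding coset_rep_def by (rule someI)
  then show "coset_rep c \<in> U"
    using u \<open>V \<subseteq> U\<close> sU by (auto simp: r_coset_def subset_iff subgroup.m_closed)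
  show "c = V #> coset_rep c" using u rc UG repr_independence[OF _ _ sV] by blast
qed

text \<open>This permutation of the cosets reindexes one of the two sums compared in
  \<open>riemann_sum_almost_invariant\<close>.\<close>

lemma bij_betw_cosets_in_translate:
  assumes sU: "subgroup U G" and VG: "V \<subseteq> carrier G" and g: "g \<in> U"
  shows "bij_betw (\<lambda>c. c #> g) (cosets_in G U V) (cosets_in G U V)"
proof (rule bij_betwI[where g = "\<lambda>c. c #> inv g"])
  have UG: "U \<subseteq> carrier G" using sU subgroup.subset by blast
  have *: "(\<lambda>c. c #> h) \<in> cosets_in G U V \<rightarrow> cosets_in G U V" if h: "h \<in> U" for h
  proof
    fix c assume "c \<in> cosets_in G U V"
    then obtain u where u: "u \<in> U" "c = V #> u" by (auto simp: cosets_in_def)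
    then have "c #> h = V #> (u \<otimes> h)" using VG UG h by (simp add: coset_mult_assoc subset_iff)
    then show "c #> h \<in> cosets_in G U V"
      using u h sU by (auto simp: cosets_in_def subgroup.m_closed)
  qed
  show "(\<lambda>c. c #> g) \<in> cosets_in G U V \<rightarrow> cosets_in G U V" using *[OF g] .
  show "(\<lambda>c. c #> inv g) \<in> cosets_in G U V \<rightarrow> cosets_in G U V"
    using *[of "inv g"] g sU by (simp add: subgroup.m_inv_closed)
  have cG: "c \<subseteq> carrier G" if c: "c \<in> cosets_in G U V" for c
  proof -
    obtain u where "u \<in> U" "c = V #> u" using c by (auto simp: cosets_in_def)
    moreover have "u \<in> carrier G" using \<open>u \<in> U\<close> UG by blast
    ultimately show ?thesis using r_coset_subset_G[OF VG] by simp
  qed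
  have gG: "g \<in> carrier G" using g UG by blast
  show "c #> g #> inv g = c" if "c \<in> cosets_in G U V" for c
    using cG[OF that] gG by (simp add: coset_mult_assoc)
  show "c #> inv g #> g = c" if "c \<in> cosets_in G U V" for c
    using cG[OF that] gG by (simp add: coset_mult_assoc)
qed

end

section \<open>Integral flows on graphs without finite components\<close>

text \<open>The form of compactness used twice below: to glue finite flows and to find a mean among
  approximate ones.\<close>

lemma compact_space_indexed_fip:
  assumes "compact_space P" and clo: "\<And>i. i \<in> I \<Longrightarrow> closedin P (C i)"
    and fip: "\<And>A. finite A \<Longrightarrow> A \<subseteq> I \<Longrightarrow> topspace P \<inter> (\<Inter>i\<in>A. C i) \<noteq> {}"
  shows "topspace P \<inter> (\<Inter>i\<in>I. C i) \<noteq> {}"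
proof -
  have "compactin P (topspace P)"
    using assms(1) by (simp add: compact_space_def)
  then have *: "\<forall>\<U>. (\<forall>D\<in>\<U>. closedin P D) \<and> (\<forall>\<F>. finite \<F> \<and> \<F> \<subseteq> \<U> \<longrightarrow> topspace P \<inter> \<Inter>\<F> \<noteq> {})
      \<longrightarrow> topspace P \<inter> \<Inter>\<U> \<noteq> {}"
    unfolding compactin_fip by (rule conjunct2)
  show ?thesis
  proof (rule *[rule_format], intro conjI ballI allI impI)
    show "closedin P D" if "D \<in> C ` I" for D
      using that clo by blast
    show "topspace P \<inter> \<Inter>\<F> \<noteq> {}" if "finite \<F> \<and> \<F> \<subseteq> C ` I" for \<F>
      using that fip finite_subset_image[of \<F> C I] by metis
  qed
qed

text \<open>Think of \<open>f s x\<close> as a flow along the edges from \<open>x\<close> to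
  \<open>\<sigma> s x\<close>. Since no finite set is invariant, a unit mass at any point of
  \<open>A\<close> can be carried along edges to a point outside \<open>A\<close>, where the
  compensating mass is invisible. Combining these flows with coefficients \<phi> solves the equation
  on \<open>A\<close>.\<close>

lemma finite_divergence_solution:
  fixes \<sigma> :: "'s \<Rightarrow> 'x \<Rightarrow> 'x" and \<phi> :: "'x \<Rightarrow> int"
  assumes F: "finite F" and bij: "\<And>s. s \<in> F \<Longrightarrow> bij_betw (\<sigma> s) Y Y"
    and noinv: "\<And>A. finite A \<Longrightarrow> A \<subseteq> Y \<Longrightarrow> A \<noteq> {} \<Longrightarrow> \<exists>s\<in>F. \<sigma> s ` A \<noteq> A"
    and A: "finite A" "A \<subseteq> Y"
  shows "\<exists>f :: 's \<Rightarrow> 'x \<Rightarrow> int. \<forall>x\<in>A. (\<Sum>s\<in>F. f s (\<sigma> s x) - f s x) = \<phi> x"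
proof -
  define dv :: "('s \<Rightarrow> 'x \<Rightarrow> int) \<Rightarrow> 'x \<Rightarrow> int"
    where "dv f x = (\<Sum>s\<in>F. f s (\<sigma> s x) - f s x)" for f x
  \<comment> \<open>\<open>R a b\<close> says that the difference of the point masses at
    \<open>a\<close> and \<open>b\<close> is a divergence on all of \<open>Y\<close>.\<close>
  define R where "R a b \<longleftrightarrow> (\<exists>f. \<forall>x\<in>Y. dv f x = of_bool (x = a) - of_bool (x = b))" for a b
  have R_refl: "R a a" for a
    unfolding R_def by (intro exI[of _ "\<lambda>_ _. 0"]) (simp add: dv_def)
  have R_trans: "R a c" if ab: "R a b" and bc: "R b c" for a b c
  proof -
    obtain f g where "\<forall>x\<in>Y. dv f x = of_bool (x = a) - of_bool (x = b)"
      "\<forall>x\<in>Y. dv g x = of_bool (x = b) - of_bool (x = c)"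
      using ab bc unfolding R_def by blast
    moreover have "dv (\<lambda>s x. f s x + g s x) x = dv f x + dv g x" for x
      unfolding dv_def sum.distrib[symmetric] by (rule sum.cong) auto
    ultimately show ?thesis
      unfolding R_def by (intro exI[of _ "\<lambda>s x. f s x + g s x"]) simp
  qed
  have R_step: "R a (\<sigma> s a)" if s: "s \<in> F" and a: "a \<in> Y" for s a
  proof -
    \<comment> \<open>One unit placed at \<open>\<sigma> s a\<close> is seen from \<open>a\<close>
      with sign plus and from \<open>\<sigma> s a\<close> with sign minus.\<close>
    define f where "f t x = (if t = s then of_bool (x = \<sigma> s a) else (0::int))" for t x
    have "dv f x = of_bool (x = a) - of_bool (x = \<sigma> s a)" if x: "x \<in> Y" for x
    proof -
      have "dv f x = (\<Sum>t\<in>F. if t = s then of_bool (\<sigma> s x = \<sigma> s a) - of_bool (x = \<sigma> s a) else 0)"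
        unfolding dv_def f_def by (rule sum.cong) auto
      also have "\<dots> = of_bool (\<sigma> s x = \<sigma> s a) - of_bool (x = \<sigma> s a)"
        using F s by simp
      also have "\<sigma> s x = \<sigma> s a \<longleftrightarrow> x = a"
        using bij[OF s] x a by (metis bij_betw_imp_inj_on inj_on_eq_iff)
      finally show ?thesis .
    qed
    then show ?thesis unfolding R_def by blast
  qed
  \<comment> \<open>The points of \<open>A\<close> related to \<open>a\<close> form a finite
    nonempty set \<open>B\<close>. If every \<open>\<sigma> s\<close> mapped \<open>B\<close> into
    itself, injectivity would make it permute \<open>B\<close>; so some step leaves
    \<open>B\<close>, and by transitivity of \<open>R\<close> it also leaves
    \<open>A\<close>.\<close>
  have escape: "\<exists>b\<in>Y - A. R a b" if a: "a \<in> A" for a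
  proof -
    define B where "B = {b \<in> A. R a b}"
    have B: "finite B" "B \<subseteq> Y" "B \<noteq> {}" using A a R_refl by (auto simp: B_def)
    then obtain s where s: "s \<in> F" "\<sigma> s ` B \<noteq> B" using noinv by blast
    have inj: "inj_on (\<sigma> s) B"
      using bij[OF s(1)] B(2) by (meson bij_betw_imp_inj_on inj_on_subset)
    have "\<not> \<sigma> s ` B \<subseteq> B" using endo_inj_surj[OF B(1) _ inj] s(2) by blast
    then obtain b where b: "b \<in> B" "\<sigma> s b \<notin> B" by blast
    then have "R a (\<sigma> s b)" using R_trans R_step s(1) B(2) by (auto simp: B_def)
    moreover have "\<sigma> s b \<in> Y" using bij[OF s(1)] b B(2) by (meson bij_betwE subsetD)
    ultimately show ?thesis using b by (auto simp: B_def)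
  qed
  have "\<exists>f. \<forall>x\<in>A. dv f x = of_bool (x = a)" if a: "a \<in> A" for a
  proof -
    obtain b f where b: "b \<notin> A" and f: "\<forall>x\<in>Y. dv f x = of_bool (x = a) - of_bool (x = b)"
      using escape[OF a] unfolding R_def by blast
    have "dv f x = of_bool (x = a)" if "x \<in> A" for x
    proof -
      have "x \<noteq> b" "x \<in> Y" using that b A(2) by auto
      then show ?thesis using f by simp
    qed
    then show ?thesis by blast
  qed
  then obtain f where f: "\<And>a x. a \<in> A \<Longrightarrow> x \<in> A \<Longrightarrow> dv (f a) x = of_bool (x = a)"
    by metis
  have "dv (\<lambda>s x. \<Sum>a\<in>A. \<phi> a * f a s x) x = \<phi> x" if x: "x \<in> A" for x
  proof -
    have "dv (\<lambda>s x. \<Sum>a\<in>A. \<phi> a * f a s x) x = (\<Sum>s\<in>F. \<Sum>a\<in>A. \<phi> a * (f a s (\<sigma> s x) - f a s x))"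
      unfolding dv_def by (intro sum.cong refl) (simp only: sum_subtractf right_diff_distrib)
    also have "\<dots> = (\<Sum>a\<in>A. \<phi> a * dv (f a) x)"
      unfolding dv_def sum_distrib_left by (rule sum.swap)
    also have "\<dots> = (\<Sum>a\<in>A. if x = a then \<phi> a else 0)"
      by (intro sum.cong refl) (simp add: f x)
    also have "\<dots> = \<phi> x" using A(1) x by simp
    finally show ?thesis .
  qed
  then show ?thesis
    unfolding dv_def by (intro exI[of _ "\<lambda>s x. \<Sum>a\<in>A. \<phi> a * f a s x"]) blast
qed

text \<open>The finite solutions glue by Tychonoff's theorem: reducing the flow modulo \<open>n\<close> makes
  the set of values of each edge finite.\<close>

lemma divergence_solution_mod:
  fixes \<sigma> :: "'s \<Rightarrow> 'x \<Rightarrow> 'x" and \<phi> :: "'x \<Rightarrow> int" and n :: nat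
  assumes F: "finite F" and bij: "\<And>s. s \<in> F \<Longrightarrow> bij_betw (\<sigma> s) Y Y"
    and noinv: "\<And>A. finite A \<Longrightarrow> A \<subseteq> Y \<Longrightarrow> A \<noteq> {} \<Longrightarrow> \<exists>s\<in>F. \<sigma> s ` A \<noteq> A"
    and n: "n > 0"
  shows "\<exists>f :: 's \<Rightarrow> 'x \<Rightarrow> int. \<forall>x\<in>Y. int n dvd \<phi> x - (\<Sum>s\<in>F. f s (\<sigma> s x) - f s x)"
proof -
  define P where "P = product_topology (\<lambda>_. subtopology euclideanreal (real ` {..<n})) (F \<times> Y)"
  \<comment> \<open>A congruence modulo \<open>n\<close> is encoded as integrality of a real
    quotient. It is a closed condition, because \<open>E x\<close> depends continuously on finitely
    many coordinates and the integers are closed in the reals.\<close>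
  define E where "E x h = (real_of_int (\<phi> x) - (\<Sum>s\<in>F. h (s, \<sigma> s x) - h (s, x))) / real n"
    for x and h :: "'s \<times> 'x \<Rightarrow> real"
  define C where "C x = {h \<in> topspace P. E x h \<in> \<int>}" for x
  have Y\<sigma>: "\<sigma> s x \<in> Y" if "s \<in> F" "x \<in> Y" for s x
    using bij that by (meson bij_betwE)
  have "compact_space P"
    unfolding P_def compact_space_product_topology
    by (intro disjI2 ballI) (auto intro!: compact_space_subtopology finite_imp_compact)
  moreover have "closedin P (C x)" if x: "x \<in> Y" for x
  proof -
    have proj: "continuous_map P euclideanreal (\<lambda>h. h i)" if "i \<in> F \<times> Y" for i
      using continuous_map_product_projection[OF that, of "\<lambda>_. subtopology euclideanreal (real ` {..<n})"]
      unfolding P_def by (rule continuous_map_into_fulltopology)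
    have "continuous_map P euclideanreal (\<lambda>h. E x h)"
      unfolding E_def divide_inverse using x Y\<sigma> n
      by (intro continuous_map_real_mult continuous_map_diff continuous_map_sum F proj
          continuous_map_const[THEN iffD2]) auto
    then have "closedin P {h \<in> topspace P. E x h \<in> \<int>}"
      by (rule closedin_continuous_map_preimage) (simp add: closed_Ints)
    then show ?thesis by (simp add: C_def)
  qed
  moreover have "topspace P \<inter> (\<Inter>x\<in>A. C x) \<noteq> {}" if A: "finite A" "A \<subseteq> Y" for A
  proof -
    obtain f :: "'s \<Rightarrow> 'x \<Rightarrow> int" where f: "\<And>x. x \<in> A \<Longrightarrow> (\<Sum>s\<in>F. f s (\<sigma> s x) - f s x) = \<phi> x"
      using finite_divergence_solution[OF F bij noinv A, of \<phi>] by blast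
    define h where "h = restrict (\<lambda>(s, x). real_of_int (f s x mod int n)) (F \<times> Y)"
    have hP: "h \<in> topspace P"
    proof -
      have "real_of_int (a mod int n) \<in> real ` {..<n}" for a
        using n by (intro image_eqI[of _ _ "nat (a mod int n)"]) (auto simp: nat_less_iff)
      then show ?thesis unfolding P_def h_def by auto
    qed
    have "h \<in> C x" if x: "x \<in> A" for x
    proof -
      have xY: "x \<in> Y" using x A by blast
      \<comment> \<open>\<open>S\<close> collects the quotients lost when the flow is reduced modulo
        \<open>n\<close>. The divergence changes by \<open>n * S\<close>, so the value of
        \<open>E x\<close> at the reduced flow is the integer \<open>S\<close>.\<close>
      define S where "S = (\<Sum>s\<in>F. f s (\<sigma> s x) div int n - f s x div int n)"
      have "(\<Sum>s\<in>F. f s (\<sigma> s x) mod int n - f s x mod int n) + int n * S =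
          (\<Sum>s\<in>F. f s (\<sigma> s x) - f s x)"
        unfolding S_def sum_distrib_left sum.distrib[symmetric]
      proof (intro sum.cong refl)
        fix s
        show "f s (\<sigma> s x) mod int n - f s x mod int n
            + int n * (f s (\<sigma> s x) div int n - f s x div int n) = f s (\<sigma> s x) - f s x"
          using mult_div_mod_eq[of "int n" "f s x"] mult_div_mod_eq[of "int n" "f s (\<sigma> s x)"]
          unfolding right_diff_distrib by linarith
      qed
      then have "(\<Sum>s\<in>F. f s (\<sigma> s x) mod int n - f s x mod int n) = \<phi> x - int n * S"
        using f[OF x] by linarith
      moreover have "(\<Sum>s\<in>F. h (s, \<sigma> s x) - h (s, x)) =
          real_of_int (\<Sum>s\<in>F. f s (\<sigma> s x) mod int n - f s x mod int n)"
        unfolding of_int_sum using xY Y\<sigma> by (intro sum.cong) (auto simp: h_def)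
      ultimately have "E x h = real_of_int S"
        unfolding E_def using n by simp
      then show ?thesis unfolding C_def using hP by simp
    qed
    then show ?thesis using hP by blast
  qed
  ultimately have "topspace P \<inter> \<Inter>(C ` Y) \<noteq> {}"
    by (rule compact_space_indexed_fip)
  then obtain h where h: "h \<in> topspace P" "\<And>x. x \<in> Y \<Longrightarrow> E x h \<in> \<int>" by (auto simp: C_def)
  \<comment> \<open>The coordinates of a point of \<open>P\<close> are natural numbers, so taking
    floors recovers an integral flow without changing it.\<close>
  have hf: "h (s, x) = real_of_int \<lfloor>h (s, x)\<rfloor>" if "s \<in> F" "x \<in> Y" for s x
  proof -
    have "h (s, x) \<in> real ` {..<n}" using h(1) that by (auto simp: P_def PiE_iff)
    then show ?thesis by auto
  qed
  have "int n dvd \<phi> x - (\<Sum>s\<in>F. \<lfloor>h (s, \<sigma> s x)\<rfloor> - \<lfloor>h (s, x)\<rfloor>)" (is "_ dvd ?e") if x: "x \<in> Y" for x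
  proof -
    have "(\<Sum>s\<in>F. h (s, \<sigma> s x) - h (s, x)) = real_of_int (\<Sum>s\<in>F. \<lfloor>h (s, \<sigma> s x)\<rfloor> - \<lfloor>h (s, x)\<rfloor>)"
      unfolding of_int_sum using x Y\<sigma> hf by (intro sum.cong) auto
    then have "E x h = real_of_int ?e / real n" unfolding E_def by simp
    then obtain k where "real_of_int ?e / real n = real_of_int k" using h(2)[OF x] by (metis Ints_cases)
    then have "real_of_int ?e = real_of_int (int n * k)" using n by (simp add: field_simps)
    then have "?e = int n * k" using of_int_eq_iff by blast
    then show ?thesis by simp
  qed
  then show ?thesis by (intro exI[of _ "\<lambda>s x. \<lfloor>h (s, x)\<rfloor>"]) blast
qed

section \<open>Constraints imposed by an invariant mean\<close>

locale Qp_tdlc = Qp_model p nv + tdlc G T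
  for p :: nat and nv :: "'k::field_char_0 \<Rightarrow> real"
    and G :: "('g, 'b) monoid_scheme" (structure) and T :: "'g topology"
begin

abbreviation "CB \<equiv> Cb G T nv"

abbreviation "norm_sup \<equiv> sup_norm G nv"

section \<open>The bounded continuous functions as a translation-invariant vector space\<close>

lemma CbD:
  assumes "f \<in> CB"
  shows "continuous_map T (nv_topology nv) f" "x \<notin> carrier G \<Longrightarrow> f x = 0"
    "bdd_above ((\<lambda>x. nv (f x)) ` carrier G)"
  using assms by (auto simp: Cb_def bdd_above_def)

lemma CbI:
  assumes "continuous_map T (nv_topology nv) f" "\<And>x. x \<notin> carrier G \<Longrightarrow> f x = 0"
    "\<And>x. x \<in> carrier G \<Longrightarrow> nv (f x) \<le> B"
  shows "f \<in> CB"
  using assms by (auto simp: Cb_def)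

lemma nv_le_sup_norm:
  assumes "f \<in> CB" "x \<in> carrier G"
  shows "nv (f x) \<le> norm_sup f"
  unfolding sup_norm_def using assms CbD by (intro cSUP_upper) auto

lemma sup_norm_le:
  assumes "\<And>x. x \<in> carrier G \<Longrightarrow> nv (f x) \<le> B"
  shows "norm_sup f \<le> B"
  unfolding sup_norm_def using assms by (intro cSUP_least) auto

lemma sup_norm_nonneg: "f \<in> CB \<Longrightarrow> norm_sup f \<ge> 0"
  using nv_le_sup_norm[of f \<one>] nv_nonneg[of "f \<one>"] by (meson one_closed order_trans)

lemma Cb_add:
  assumes "f \<in> CB" "h \<in> CB"
  shows "(\<lambda>x. f x + h x) \<in> CB"
proof (rule CbI)
  show "continuous_map T (nv_topology nv) (\<lambda>x. f x + h x)"
    using assms CbD(1) continuous_map_nv_add by blast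
  show "nv (f x + h x) \<le> max (norm_sup f) (norm_sup h)" if "x \<in> carrier G" for x
    using nv_add[of "f x" "h x"] nv_le_sup_norm[OF assms(1) that] nv_le_sup_norm[OF assms(2) that]
    by linarith
qed (use assms CbD(2) in \<open>metis add_0\<close>)

lemma Cb_cmult:
  assumes "f \<in> CB"
  shows "(\<lambda>x. c * f x) \<in> CB"
proof (rule CbI)
  show "continuous_map T (nv_topology nv) (\<lambda>x. c * f x)"
    using assms CbD(1) continuous_map_nv_cmult by blast
  show "nv (c * f x) \<le> nv c * norm_sup f" if "x \<in> carrier G" for x
    unfolding nv_mult using nv_le_sup_norm[OF assms that] by (intro mult_left_mono) auto
qed (use assms CbD(2) in \<open>metis mult_zero_right\<close>)

lemma Cb_zero: "(\<lambda>_. 0) \<in> CB"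
  by (rule CbI[where B = 0]) auto

lemma Cb_sum:
  "finite I \<Longrightarrow> (\<And>i. i \<in> I \<Longrightarrow> f i \<in> CB) \<Longrightarrow> (\<lambda>x. \<Sum>i\<in>I. f i x) \<in> CB"
proof (induction I rule: finite_induct)
  case empty
  then show ?case using Cb_zero by simp
next
  case (insert i I)
  then show ?case using Cb_add[of "f i" "\<lambda>x. \<Sum>i\<in>I. f i x"] by simp
qed

lemma Cb_translate:
  assumes f: "f \<in> CB" and g: "g \<in> carrier G"
  shows "translate G g f \<in> CB"
proof (rule CbI)
  have "continuous_map T (nv_topology nv) (\<lambda>x. f (inv g \<otimes> x))"
    using continuous_map_compose[OF continuous_mult_left[of "inv g"] CbD(1)[OF f]] g by (simp add: o_def)
  then show "continuous_map T (nv_topology nv) (translate G g f)"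
    by (rule continuous_map_eq) (simp add: translate_def topspace_T)
  show "nv (translate G g f x) \<le> norm_sup f" if "x \<in> carrier G" for x
    using nv_le_sup_norm[OF f, of "inv g \<otimes> x"] g that by (simp add: translate_def)
qed (simp add: translate_def)

text \<open>The test functions fed to a given mean (constants, indicators, functions lifted from
  \<open>G/V\<close>) are all locally constant.\<close>

lemma Cb_locally_constant:
  assumes "\<And>x. x \<in> carrier G \<Longrightarrow> \<exists>N. openin T N \<and> x \<in> N \<and> (\<forall>y\<in>N. f y = f x)"
    and "\<And>x. x \<notin> carrier G \<Longrightarrow> f x = 0"
    and "\<And>x. x \<in> carrier G \<Longrightarrow> nv (f x) \<le> B"
  shows "f \<in> CB"
proof (rule CbI)
  show "continuous_map T (nv_topology nv) f"
    unfolding continuous_map_nv_iff topspace_T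
  proof (intro ballI allI impI)
    fix x and e :: real assume x: "x \<in> carrier G" and e: "e > 0"
    obtain N where N: "openin T N" "x \<in> N" and const: "\<And>y. y \<in> N \<Longrightarrow> f y = f x"
      using assms(1)[OF x] by blast
    have "nv (f y - f x) < e" if "y \<in> N" for y
      unfolding const[OF that] using e by simp
    then show "\<exists>U. openin T U \<and> x \<in> U \<and> (\<forall>y\<in>U. nv (f y - f x) < e)"
      using N by blast
  qed
qed (use assms in auto)

lemma one_G_Cb: "one_G G \<in> CB"
proof (rule Cb_locally_constant[where B = 1])
  show "\<exists>N. openin T N \<and> x \<in> N \<and> (\<forall>y\<in>N. one_G G y = one_G G x)" if "x \<in> carrier G" for x
    using that openin_topspace[of T] by (intro exI[of _ "carrier G"]) (auto simp: one_G_def topspace_T)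
qed (auto simp: one_G_def)

section \<open>Consequences of the existence of an invariant mean with bound
  \<open>C\<close>\<close>

context
  fixes m C
  assumes mean: "normed_mean G T nv m" and invariant: "left_invariant G T nv m"
    and bound: "\<And>f. f \<in> CB \<Longrightarrow> nv (m f) \<le> C * norm_sup f"
begin

lemma mean_add: "f \<in> CB \<Longrightarrow> h \<in> CB \<Longrightarrow> m (\<lambda>x. f x + h x) = m f + m h"
  and mean_cmult: "f \<in> CB \<Longrightarrow> m (\<lambda>x. c * f x) = c * m f"
  and mean_one: "m (one_G G) = 1"
  using mean by (auto simp: normed_mean_def)

lemma mean_translate: "g \<in> carrier G \<Longrightarrow> f \<in> CB \<Longrightarrow> m (translate G g f) = m f"
  using invariant by (simp add: left_invariant_def)

lemma mean_sum:
  "finite I \<Longrightarrow> (\<And>i. i \<in> I \<Longrightarrow> f i \<in> CB) \<Longrightarrow> m (\<lambda>x. \<Sum>i\<in>I. f i x) = (\<Sum>i\<in>I. m (f i))"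
proof (induction I rule: finite_induct)
  case empty
  then show ?case using mean_cmult[OF Cb_zero, of 0] by simp
next
  case (insert i I)
  then show ?case
    using mean_add[of "f i" "\<lambda>x. \<Sum>i\<in>I. f i x"] Cb_sum[of I f] by simp
qed

lemma mean_bound_nonneg: "C \<ge> 0"
proof -
  have "norm_sup (one_G G) \<le> 1" by (rule sup_norm_le) (simp add: one_G_def)
  moreover have "1 \<le> C * norm_sup (one_G G)" using bound[OF one_G_Cb] mean_one by simp
  moreover have "norm_sup (one_G G) \<ge> 0" using sup_norm_nonneg one_G_Cb by blast
  ultimately show ?thesis
    by (smt (verit, best) mult_nonpos_nonneg)
qed

lemma nv_mean_le: "f \<in> CB \<Longrightarrow> (\<And>x. x \<in> carrier G \<Longrightarrow> nv (f x) \<le> 1) \<Longrightarrow> nv (m f) \<le> C"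
  using bound[of f] sup_norm_le[of f 1] mult_left_mono[OF _ mean_bound_nonneg, of "norm_sup f" 1] by simp

text \<open>Translates of one indicator function \<open>f\<close>, one for each coset, add up to the
  constant 1. Invariance gives \<open>index * m f = 1\<close>, while the index has absolute value at
  most \<open>1 / p ^ k\<close> and \<open>m f\<close> at most \<open>C\<close>.\<close>

lemma mean_bound_ge_index:
  assumes U: "open_subgroup G T U" and V: "open_subgroup G T V" and "V \<subseteq> U"
    and fin: "finite (cosets_in G U V)" and dvd: "p ^ k dvd index G U V"
  shows "real p ^ k \<le> C"
proof -
  have sU: "subgroup U G" and sV: "subgroup V G" and oV: "openin T V"
    using U V by (auto simp: open_subgroup_def)
  have UG: "U \<subseteq> carrier G" and VG: "V \<subseteq> carrier G"
    using sU sV subgroup.subset by blast+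
  \<comment> \<open>\<open>rep x\<close> depends only on the coset \<open>U #> x\<close>, so the
    \<open>U\<close>-part \<open>x \<otimes> inv (rep x)\<close> is equivariant under left
    multiplication by \<open>U\<close>.\<close>
  define rep where "rep x = (SOME y. y \<in> U #> x)" for x
  have rep: "rep x \<in> carrier G" "x \<otimes> inv (rep x) \<in> U" if "x \<in> carrier G" for x
  proof -
    have "x \<in> U #> x" using rcos_self[OF that sU] .
    then have r: "rep x \<in> U #> x" unfolding rep_def by (rule someI)
    then show rG: "rep x \<in> carrier G" using r_coset_subset_G[OF UG that] by blast
    have "rep x \<otimes> inv x \<in> U" using r mem_r_coset_iff[OF that UG rG] by simp
    then have "inv (rep x \<otimes> inv x) \<in> U" using sU by (simp add: subgroup.m_inv_closed)
    then show "x \<otimes> inv (rep x) \<in> U" using rG that by (simp add: inv_mult_group)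
  qed
  have rep_mult: "rep (u \<otimes> x) = rep x" if "u \<in> U" "x \<in> carrier G" for u x
  proof -
    have "u \<otimes> x \<in> U #> x" using that by (auto simp: r_coset_def)
    then have "U #> (u \<otimes> x) = U #> x" using repr_independence[OF _ that(2) sU] by simp
    then show ?thesis by (simp add: rep_def)
  qed
  define f where "f x = (if x \<in> carrier G \<and> x \<otimes> inv (rep x) \<in> V then 1 else 0 :: 'k)" for x
  have fCB: "f \<in> CB"
  proof (rule Cb_locally_constant[where B = 1])
    fix x assume x: "x \<in> carrier G"
    have "f y = f x" if y: "y \<in> V #> x" for y
    proof -
      obtain v where v: "v \<in> V" "y = v \<otimes> x" using y by (auto simp: r_coset_def)
      have vG: "v \<in> carrier G" using v VG by blast
      have "y \<otimes> inv (rep y) = v \<otimes> (x \<otimes> inv (rep x))"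
        using v x vG rep_mult[of v x] \<open>V \<subseteq> U\<close> rep(1)[OF x] by (auto simp: m_assoc)
      moreover have "v \<otimes> z \<in> V \<longleftrightarrow> z \<in> V" if z: "z \<in> carrier G" for z
      proof
        assume "v \<otimes> z \<in> V"
        then have "inv v \<otimes> (v \<otimes> z) \<in> V" using v sV by (simp add: subgroup.m_closed subgroup.m_inv_closed)
        then show "z \<in> V" using vG z by (simp add: m_assoc[symmetric])
      qed (use v sV in \<open>simp add: subgroup.m_closed\<close>)
      ultimately show ?thesis using v vG x rep(1)[OF x] by (simp add: f_def)
    qed
    then show "\<exists>N. openin T N \<and> x \<in> N \<and> (\<forall>y\<in>N. f y = f x)"
      using openin_r_coset[OF oV x] rcos_self[OF x sV] by blast
  qed (auto simp: f_def)
  define r where "r = coset_rep"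
  note r = coset_rep[OF sU sV \<open>V \<subseteq> U\<close>, folded r_def]
  \<comment> \<open>If \<open>u\<close> is the \<open>U\<close>-part of \<open>x\<close>, the term
    of \<open>c\<close> is 1 exactly when \<open>r c \<otimes> u \<in> V\<close>, which singles out
    the coset \<open>V #> inv u\<close>.\<close>
  have "(\<Sum>c\<in>cosets_in G U V. translate G (inv (r c)) f x) = one_G G x" for x
  proof (cases "x \<in> carrier G")
    case True
    define u where "u = x \<otimes> inv (rep x)"
    have u: "u \<in> U" "u \<in> carrier G" using rep[OF True] UG by (auto simp: u_def)
    have "translate G (inv (r c)) f x = (if c = V #> inv u then 1 else 0)"
      if c: "c \<in> cosets_in G U V" for c
    proof -
      have rU: "r c \<in> U" "r c \<in> carrier G" using r(1)[OF c] UG by auto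
      have "translate G (inv (r c)) f x = f (r c \<otimes> x)"
        using True rU by (simp add: translate_def)
      also have "\<dots> = (if r c \<otimes> u \<in> V then 1 else 0)"
        using True rU rep_mult[OF rU(1) True] rep(1)[OF True] by (simp add: f_def u_def m_assoc)
      also have "r c \<otimes> u \<in> V \<longleftrightarrow> r c \<in> V #> inv u"
        using mem_r_coset_iff[of "inv u" V "r c"] u rU VG by simp
      also have "\<dots> \<longleftrightarrow> c = V #> inv u"
        using repr_independence[of "r c" V "inv u"] r(2)[OF c] u(2) sV rcos_self[OF rU(2) sV] by auto
      finally show ?thesis .
    qed
    then have "(\<Sum>c\<in>cosets_in G U V. translate G (inv (r c)) f x)
        = (\<Sum>c\<in>cosets_in G U V. if c = V #> inv u then 1 else 0)"
      by (intro sum.cong) auto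
    also have "\<dots> = 1"
    proof -
      have "V #> inv u \<in> cosets_in G U V"
        using u sU by (auto simp: cosets_in_def subgroup.m_inv_closed)
      then show ?thesis using fin by simp
    qed
    finally show ?thesis using True by (simp add: one_G_def)
  qed (simp add: translate_def one_G_def)
  then have "one_G G = (\<lambda>x. \<Sum>c\<in>cosets_in G U V. translate G (inv (r c)) f x)" by auto
  then have "1 = m (\<lambda>x. \<Sum>c\<in>cosets_in G U V. translate G (inv (r c)) f x)"
    using mean_one by simp
  also have "\<dots> = (\<Sum>c\<in>cosets_in G U V. m (translate G (inv (r c)) f))"
    using fin r(1) UG fCB by (intro mean_sum Cb_translate) auto
  also have "\<dots> = (\<Sum>c\<in>cosets_in G U V. m f)"
    using r(1) UG fCB by (intro sum.cong mean_translate) auto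
  also have "\<dots> = of_nat (index G U V) * m f" by (simp add: index_def)
  finally have "nv (of_nat (index G U V)) * nv (m f) = 1"
    by (metis nv_mult nv_one)
  moreover have "nv (of_nat (index G U V)) * nv (m f) \<le> 1 / real p ^ k * C"
    using nv_of_nat_le_if_dvd[OF dvd] nv_mean_le[OF fCB] p_gt_1
    by (intro mult_mono) (auto simp: f_def)
  ultimately show ?thesis using p_gt_1 by (simp add: field_simps)
qed

theorem mean_imp_locally_elliptic: "locally_elliptic G T"
proof (rule ccontr)
  assume "\<not> locally_elliptic G T"
  then obtain F where F: "finite F" "F \<subseteq> carrier G"
    and noK: "\<And>K. subgroup K G \<Longrightarrow> compactin T K \<Longrightarrow> \<not> F \<subseteq> K"
    unfolding locally_elliptic_def by blast
  obtain V where V: "open_subgroup G T V" "compactin T V"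
    using van_Dantzig[of "topspace T"] by (metis one_closed openin_topspace topspace_T)
  have sV: "subgroup V G" and oV: "openin T V" using V by (auto simp: open_subgroup_def)
  have VG: "V \<subseteq> carrier G" using sV subgroup.subset by blast
  define Y where "Y = (\<lambda>x. x <# V) ` carrier G"
  \<comment> \<open>The inverse matches the convention of \<open>translate\<close>: on functions
    lifted from \<open>G/V\<close>, translation by \<open>s\<close> is composition with
    \<open>\<sigma> s\<close>.\<close>
  define \<sigma> where "\<sigma> s c = inv s <# c" for s and c :: "'g set"
  have YG: "c \<subseteq> carrier G" if "c \<in> Y" for c
    using that l_coset_subset_G[OF VG] by (auto simp: Y_def)
  have \<sigma>_coset: "\<sigma> s (x <# V) = (inv s \<otimes> x) <# V" if "s \<in> F" "x \<in> carrier G" for s x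
    unfolding \<sigma>_def using that F(2) VG by (intro lcos_m_assoc) auto
  have bij: "bij_betw (\<sigma> s) Y Y" if s: "s \<in> F" for s
  proof (rule bij_betwI[where g = "\<lambda>c. s <# c"])
    have sG: "s \<in> carrier G" using s F by blast
    show "\<sigma> s \<in> Y \<rightarrow> Y" using \<sigma>_coset[OF s] sG by (auto simp: Y_def)
    show "(\<lambda>c. s <# c) \<in> Y \<rightarrow> Y" using sG VG by (auto simp: Y_def lcos_m_assoc)
    show "s <# \<sigma> s c = c" if "c \<in> Y" for c
      unfolding \<sigma>_def using sG YG[OF that] by (simp add: lcos_m_assoc lcos_mult_one)
    show "\<sigma> s (s <# c) = c" if "c \<in> Y" for c
      unfolding \<sigma>_def using sG YG[OF that] by (simp add: lcos_m_assoc lcos_mult_one)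
  qed
  \<comment> \<open>The union of finitely many cosets is compact and open, so if \<open>F\<close>
    preserved it, its stabilizer would be a compact subgroup containing \<open>F\<close>.\<close>
  have noinv: "\<exists>s\<in>F. \<sigma> s ` A \<noteq> A" if A: "finite A" "A \<subseteq> Y" "A \<noteq> {}" for A
  proof (rule ccontr)
    assume "\<not> ?thesis"
    then have inv: "\<sigma> s ` A = A" if "s \<in> F" for s using that by blast
    have "c \<noteq> {}" if "c \<in> Y" for c
      using that subgroup.one_closed[OF sV] by (auto simp: Y_def l_coset_def)
    then have "\<Union>A \<noteq> {}" using A by blast
    moreover have "openin T (\<Union>A)"
      using A(2) openin_l_coset[OF oV] by (intro openin_Union) (auto simp: Y_def)
    moreover have "compactin T (\<Union>A)"
      using A compactin_l_coset[OF V(2)] by (intro compactin_Union) (auto simp: Y_def)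
    ultimately have stab: "compactin T (set_stabilizer (\<Union>A))" "subgroup (set_stabilizer (\<Union>A)) G"
      using set_stabilizer_compact_open[of "\<Union>A"] by (auto simp: open_subgroup_def)
    have "s \<in> set_stabilizer (\<Union>A)" if s: "s \<in> F" for s
    proof -
      have sG: "s \<in> carrier G" using s F by blast
      have "inv s <# \<Union>A = \<Union>(\<sigma> s ` A)" by (auto simp: l_coset_def \<sigma>_def)
      then have "inv s \<in> set_stabilizer (\<Union>A)" using inv[OF s] sG by (simp add: set_stabilizer_def)
      then show ?thesis using subgroup.m_inv_closed[OF stab(2)] sG by fastforce
    qed
    then show False using noK[OF stab(2,1)] by blast
  qed
  \<comment> \<open>Integers have p-adic absolute value at most 1, so every integer-valued function
    on \<open>G/V\<close>, however large its values, lifts to a function of norm at most 1.\<close>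
  define \<Phi> where "\<Phi> \<phi> x = (if x \<in> carrier G then of_int (\<phi> (x <# V)) else 0 :: 'k)"
    for \<phi> :: "'g set \<Rightarrow> int" and x
  have \<Phi>_le: "nv (\<Phi> \<phi> x) \<le> 1" for \<phi> x
    by (simp add: \<Phi>_def nv_of_int_le_1)
  have \<Phi>_CB: "\<Phi> \<phi> \<in> CB" for \<phi>
  proof (rule Cb_locally_constant[where B = 1])
    fix x assume x: "x \<in> carrier G"
    have "\<Phi> \<phi> y = \<Phi> \<phi> x" if y: "y \<in> x <# V" for y
    proof -
      have "y \<in> carrier G" using y l_coset_subset_G[OF VG x] by blast
      moreover have "x <# V = y <# V" using l_repr_independence[OF y x sV] .
      ultimately show ?thesis using x by (simp add: \<Phi>_def)
    qed
    moreover have "x \<in> x <# V" using x VG subgroup.one_closed[OF sV] by (simp add: mem_l_coset_iff)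
    ultimately show "\<exists>N. openin T N \<and> x \<in> N \<and> (\<forall>y\<in>N. \<Phi> \<phi> y = \<Phi> \<phi> x)"
      using openin_l_coset[OF oV x] by blast
  qed (auto simp: \<Phi>_def nv_of_int_le_1)
  \<comment> \<open>Solve the divergence equation modulo \<open>p\<close> for \<phi>. The lifted
    divergence is a sum of differences \<open>d s\<close> between a function and its translate,
    which have mean 0; the remainder is \<open>p\<close> times a lifted integer-valued
    function.\<close>
  have step: "\<exists>\<psi>. m (\<Phi> \<phi>) = of_nat p * m (\<Phi> \<psi>)" for \<phi>
  proof -
    obtain f :: "'g \<Rightarrow> 'g set \<Rightarrow> int"
      where f: "\<And>c. c \<in> Y \<Longrightarrow> int p dvd \<phi> c - (\<Sum>s\<in>F. f s (\<sigma> s c) - f s c)"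
      using divergence_solution_mod[OF F(1) bij noinv, of p \<phi>] p_gt_1 by auto
    define \<psi> where "\<psi> c = (\<phi> c - (\<Sum>s\<in>F. f s (\<sigma> s c) - f s c)) div int p" for c
    have \<phi>: "\<phi> c = (\<Sum>s\<in>F. f s (\<sigma> s c) - f s c) + int p * \<psi> c" if "c \<in> Y" for c
      using f[OF that] by (simp add: \<psi>_def)
    define d where "d s x = translate G s (\<Phi> (f s)) x + (- 1) * \<Phi> (f s) x" for s x
    have "\<Phi> \<phi> x = (\<Sum>s\<in>F. d s x) + of_nat p * \<Phi> \<psi> x" for x
    proof (cases "x \<in> carrier G")
      case True
      then have c: "x <# V \<in> Y" by (simp add: Y_def)
      have "d s x = of_int (f s (\<sigma> s (x <# V)) - f s (x <# V))" if s: "s \<in> F" for s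
        using \<sigma>_coset[OF s True] True F(2) s by (auto simp: d_def translate_def \<Phi>_def)
      then have "(\<Sum>s\<in>F. d s x) = of_int (\<Sum>s\<in>F. f s (\<sigma> s (x <# V)) - f s (x <# V))"
        by simp
      then show ?thesis
        using \<phi>[OF c] True by (simp add: \<Phi>_def)
    qed (simp add: \<Phi>_def d_def translate_def)
    then have "m (\<Phi> \<phi>) = m (\<lambda>x. (\<Sum>s\<in>F. d s x) + of_nat p * \<Phi> \<psi> x)" by presburger
    moreover have dCB: "d s \<in> CB" and d0: "m (d s) = 0" if "s \<in> F" for s
    proof -
      have sG: "s \<in> carrier G" using that F by blast
      note t = Cb_translate[OF \<Phi>_CB sG] and c = Cb_cmult[OF \<Phi>_CB, of "- 1"]
      have d: "d s = (\<lambda>x. translate G s (\<Phi> (f s)) x + (- 1) * \<Phi> (f s) x)"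
        by (rule ext) (simp add: d_def)
      show "d s \<in> CB" unfolding d by (rule Cb_add[OF t c])
      show "m (d s) = 0"
        unfolding d mean_add[OF t c] mean_cmult[OF \<Phi>_CB] mean_translate[OF sG \<Phi>_CB] by simp
    qed
    ultimately have "m (\<Phi> \<phi>) = (\<Sum>s\<in>F. m (d s)) + of_nat p * m (\<Phi> \<psi>)"
      using mean_add[OF Cb_sum[OF F(1) dCB] Cb_cmult[OF \<Phi>_CB, of "of_nat p" \<psi>]]
        mean_sum[OF F(1) dCB] mean_cmult[OF \<Phi>_CB, of "of_nat p" \<psi>] by simp
    then show ?thesis using d0 by auto
  qed
  \<comment> \<open>Each use of \<open>step\<close> gains a factor \<open>1 / p\<close> but changes
    the function, so the bound is proved for all \<phi> at once.\<close>
  have "nv (m (\<Phi> \<phi>)) \<le> C / real p ^ k" for \<phi> k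
  proof (induction k arbitrary: \<phi>)
    case 0
    then show ?case using nv_mean_le[OF \<Phi>_CB \<Phi>_le] by simp
  next
    case (Suc k)
    obtain \<psi> where "m (\<Phi> \<phi>) = of_nat p * m (\<Phi> \<psi>)" using step by blast
    then have "nv (m (\<Phi> \<phi>)) = nv (m (\<Phi> \<psi>)) / real p" by (simp add: nv_mult nv_p)
    also have "\<dots> \<le> C / real p ^ k / real p" using Suc by (intro divide_right_mono) auto
    finally show ?case by (simp add: mult.commute)
  qed
  moreover have "\<Phi> (\<lambda>_. 1) = one_G G" by (auto simp: \<Phi>_def one_G_def)
  ultimately have "1 \<le> C / real p ^ k" for k by (metis mean_one nv_one)
  then have "real p ^ k \<le> C" for k using p_gt_1 by (simp add: field_simps)
  then show False using real_arch_pow[OF p_gt_1(1), of C] by (meson not_le)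
qed

end

section \<open>Construction of an invariant mean\<close>

text \<open>Cover \<open>U\<close> by finitely many cosets \<open>a <# V a\<close> on which
  \<open>f\<close> stays within \<open>e\<close> of \<open>f a\<close>, and intersect the subgroups
  \<open>V a\<close>. As \<open>V a\<close> is a group, \<open>u\<close> and
  \<open>u \<otimes> v\<close> stay in the same coset; by the ultrametric inequality no halving of
  \<open>e\<close> is required.\<close>

lemma uniformly_continuous_on_compact:
  assumes f: "f \<in> CB" and U: "compactin T U" and e: "e > 0"
  obtains V where "open_subgroup G T V" "\<And>u v. u \<in> U \<Longrightarrow> v \<in> V \<Longrightarrow> nv (f (u \<otimes> v) - f u) < e"
proof -
  have UG: "U \<subseteq> carrier G" using U compactin_subset_carrier by blast
  have "\<exists>V. open_subgroup G T V \<and> (\<forall>v\<in>V. nv (f (u \<otimes> v) - f u) < e)" if u: "u \<in> U" for u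
  proof -
    have uG: "u \<in> carrier G" using u UG by blast
    obtain N where N: "openin T N" "u \<in> N" "\<And>y. y \<in> N \<Longrightarrow> nv (f y - f u) < e"
      using CbD(1)[OF f, unfolded continuous_map_nv_iff topspace_T, rule_format, OF uG e] by blast
    have NG: "N \<subseteq> carrier G" using N openin_subset_carrier by blast
    have "openin T (inv u <# N)" using N uG openin_l_coset by blast
    moreover have "\<one> \<in> inv u <# N" using N uG NG by (simp add: mem_l_coset_iff)
    ultimately obtain V where V: "open_subgroup G T V" "V \<subseteq> inv u <# N"
      using van_Dantzig by blast
    have "u \<otimes> v \<in> N" if v: "v \<in> V" for v
    proof -
      have "v \<in> inv u <# N" using V v by blast
      moreover have "v \<in> carrier G" using V v by (auto simp: open_subgroup_def dest: subgroup.mem_carrier)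
      ultimately show ?thesis using mem_l_coset_iff[of "inv u" N v] uG NG by simp
    qed
    then show ?thesis using V N(3) by blast
  qed
  then obtain V where V: "\<And>u. u \<in> U \<Longrightarrow> open_subgroup G T (V u)"
    and Vf: "\<And>u v. u \<in> U \<Longrightarrow> v \<in> V u \<Longrightarrow> nv (f (u \<otimes> v) - f u) < e"
    by metis
  have sV: "subgroup (V u) G" and oV: "openin T (V u)" if "u \<in> U" for u
    using V[OF that] by (auto simp: open_subgroup_def)
  have "\<And>W. W \<in> (\<lambda>u. u <# V u) ` U \<Longrightarrow> openin T W"
    using openin_l_coset oV UG by blast
  moreover have "U \<subseteq> \<Union>((\<lambda>u. u <# V u) ` U)"
  proof
    fix u assume u: "u \<in> U"
    then have "u \<in> u <# V u"
      using UG sV[OF u] subgroup.subset[OF sV[OF u]] subgroup.one_closed[OF sV[OF u]]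
      by (subst mem_l_coset_iff) (auto simp: subset_iff)
    then show "u \<in> \<Union>((\<lambda>u. u <# V u) ` U)" using u by blast
  qed
  ultimately obtain \<F> where \<F>: "finite \<F>" "\<F> \<subseteq> (\<lambda>u. u <# V u) ` U" "U \<subseteq> \<Union>\<F>"
    using U unfolding compactin_def by metis
  then obtain A where A: "A \<subseteq> U" "finite A" "\<F> = (\<lambda>u. u <# V u) ` A"
    using finite_subset_image by metis
  have "open_subgroup G T (carrier G \<inter> (\<Inter>a\<in>A. V a))"
    using A V open_subgroup_carrier by (intro open_subgroup_Int_finite) auto
  moreover have "nv (f (u \<otimes> v) - f u) < e" if u: "u \<in> U" and v: "v \<in> carrier G \<inter> (\<Inter>a\<in>A. V a)" for u v
  proof -
    obtain a where a: "a \<in> A" "u \<in> a <# V a" using u \<F>(3) A(3) by blast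
    then obtain w where w: "w \<in> V a" "u = a \<otimes> w" by (auto simp: l_coset_def)
    have aU: "a \<in> U" using a A by blast
    have va: "v \<in> V a" using v a by blast
    have "a \<in> carrier G" "w \<in> carrier G" "v \<in> carrier G"
      using aU UG w va subgroup.mem_carrier[OF sV[OF aU]] by auto
    then have "u \<otimes> v = a \<otimes> (w \<otimes> v)" using w by (simp add: m_assoc)
    moreover have "w \<otimes> v \<in> V a" using w va sV[OF aU] by (simp add: subgroup.m_closed)
    ultimately have "nv (f (u \<otimes> v) - f a) < e" "nv (f a - f u) < e"
      using Vf[OF aU] w by (auto simp: nv_diff_commute[of "f a"])
    then show ?thesis using nv_diff_triangle[of "f (u \<otimes> v)" "f u" "f a"] by linarith
  qed
  ultimately show ?thesis using that by blast
qed

text \<open>Inverting the representatives turns the right cosets counted by \<^const>\<open>index\<close> into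
  left cosets, the ones compatible with left translation.\<close>

definition riemann_sum :: "'g set \<Rightarrow> 'g set \<Rightarrow> ('g \<Rightarrow> 'k) \<Rightarrow> 'k" where
  "riemann_sum U V f = (\<Sum>c\<in>cosets_in G U V. f (inv (coset_rep c))) / of_nat (index G U V)"

section \<open>Averages over \<open>U/V\<close> for compact open \<open>U\<close> in a
  \<open>p ^ Suc k\<close>-free group\<close>

context
  fixes U V :: "'g set" and k :: nat
  assumes U: "open_subgroup G T U" "compactin T U" and V: "open_subgroup G T V" "V \<subseteq> U"
    and free: "n_free G T (p ^ Suc k)"
begin

lemma subgroup_U: "subgroup U G" and subgroup_V: "subgroup V G" and U_subset: "U \<subseteq> carrier G" and V_subset: "V \<subseteq> carrier G"
  using U V by (auto simp: open_subgroup_def dest: subgroup.mem_carrier)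

lemma finite_cosets_UV: "finite (cosets_in G U V)"
  using finite_cosets_in[OF subgroup_U U(2) V(1)] .

lemma nv_index_ge: "nv (of_nat (index G U V)) \<ge> 1 / real p ^ k"
  using free U V finite_cosets_UV unfolding n_free_def by (intro nv_of_nat_ge_if_not_dvd) auto

lemma index_nonzero: "of_nat (index G U V) \<noteq> (0::'k)"
  using nv_index_ge p_gt_1 by (metis divide_pos_pos leD nv_zero zero_less_one zero_less_power order_less_trans)

lemma inv_coset_rep_in_U: "c \<in> cosets_in G U V \<Longrightarrow> inv (coset_rep c) \<in> U"
  using coset_rep(1)[OF subgroup_U subgroup_V V(2)] subgroup_U by (simp add: subgroup.m_inv_closed)

lemma nv_divide_index_le: "nv x \<le> B \<Longrightarrow> nv (x / of_nat (index G U V)) \<le> real p ^ k * B"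
proof -
  assume x: "nv x \<le> B"
  have "nv (x / of_nat (index G U V)) \<le> nv x / (1 / real p ^ k)"
    unfolding nv_divide using nv_index_ge p_gt_1 by (intro divide_left_mono) (auto intro!: mult_pos_pos
        simp: less_le_trans[of 0 "1 / real p ^ k"])
  also have "\<dots> \<le> real p ^ k * B" using x by (simp add: mult.commute mult_right_mono)
  finally show ?thesis .
qed

lemma riemann_sum_add:
  "riemann_sum U V (\<lambda>x. f x + h x) = riemann_sum U V f + riemann_sum U V h"
  by (simp add: riemann_sum_def sum.distrib add_divide_distrib)

lemma riemann_sum_cmult: "riemann_sum U V (\<lambda>x. c * f x) = c * riemann_sum U V f"
  by (simp add: riemann_sum_def sum_distrib_left)

lemma riemann_sum_one: "riemann_sum U V (one_G G) = 1"
proof -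
  have "(\<Sum>c\<in>cosets_in G U V. one_G G (inv (coset_rep c))) = (\<Sum>c\<in>cosets_in G U V. 1 :: 'k)"
    using inv_coset_rep_in_U U_subset by (intro sum.cong) (auto simp: one_G_def)
  then show ?thesis using index_nonzero by (simp add: riemann_sum_def index_def)
qed

lemma riemann_sum_bound:
  assumes "f \<in> CB"
  shows "nv (riemann_sum U V f) \<le> real p ^ k * norm_sup f"
  unfolding riemann_sum_def using inv_coset_rep_in_U U_subset assms
  by (intro nv_divide_index_le nv_sum_le finite_cosets_UV sup_norm_nonneg nv_le_sup_norm) auto

text \<open>After reindexing one sum by \<open>c #> g\<close>, corresponding terms evaluate
  \<open>f\<close> at points \<open>u\<close> and \<open>u \<otimes> inv v\<close> of the same left
  coset of \<open>V\<close>: only the choice of representative differs. Dividing by the index costs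
  the factor \<open>p ^ k\<close>.\<close>

lemma riemann_sum_almost_invariant:
  assumes g: "g \<in> U" and e: "e \<ge> 0"
    and unif: "\<And>u v. u \<in> U \<Longrightarrow> v \<in> V \<Longrightarrow> nv (f (u \<otimes> v) - f u) \<le> e"
  shows "nv (riemann_sum U V (translate G g f) - riemann_sum U V f) \<le> real p ^ k * e"
proof -
  let ?r = coset_rep
  have gG: "g \<in> carrier G" using g U_subset by blast
  have "(\<Sum>c\<in>cosets_in G U V. f (inv (?r c))) = (\<Sum>c\<in>cosets_in G U V. f (inv (?r (c #> g))))"
    using sum.reindex_bij_betw[OF bij_betw_cosets_in_translate[OF subgroup_U V_subset g], of "\<lambda>c. f (inv (?r c))"]
    by simp
  then have "riemann_sum U V (translate G g f) - riemann_sum U V f =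
      (\<Sum>c\<in>cosets_in G U V. translate G g f (inv (?r c)) - f (inv (?r (c #> g)))) / of_nat (index G U V)"
    by (simp add: riemann_sum_def diff_divide_distrib sum_subtractf)
  also have "nv \<dots> \<le> real p ^ k * e"
  proof (intro nv_divide_index_le nv_sum_le finite_cosets_UV e)
    fix c assume c: "c \<in> cosets_in G U V"
    have cg: "c #> g \<in> cosets_in G U V"
      using bij_betw_cosets_in_translate[OF subgroup_U V_subset g] c by (meson bij_betwE)
    have rU: "?r c \<in> U" and rcG: "?r c \<in> carrier G" and rc: "c = V #> ?r c"
      using coset_rep[OF subgroup_U subgroup_V V(2) c] U_subset by auto
    have "c #> g = V #> (?r c \<otimes> g)"
      using rc coset_mult_assoc[OF V_subset rcG gG] by simp
    moreover have "?r (c #> g) \<in> c #> g"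
      using coset_rep[OF subgroup_U subgroup_V V(2) cg] U_subset rcos_self[OF _ subgroup_V] by (metis subsetD)
    ultimately obtain v where v: "v \<in> V" "?r (c #> g) = v \<otimes> (?r c \<otimes> g)"
      by (auto simp: r_coset_def)
    have vG: "v \<in> carrier G" using v V_subset by blast
    define u where "u = inv g \<otimes> inv (?r c)"
    have "u \<in> U" unfolding u_def using g rU subgroup_U by (simp add: subgroup.m_closed subgroup.m_inv_closed)
    moreover have "inv v \<in> V" using v subgroup_V by (simp add: subgroup.m_inv_closed)
    moreover have "inv (?r (c #> g)) = u \<otimes> inv v"
      unfolding v(2) u_def using vG rcG gG by (simp add: inv_mult_group m_assoc)
    moreover have "translate G g f (inv (?r c)) = f u"
      using rcG by (simp add: translate_def u_def)
    ultimately show "nv (translate G g f (inv (?r c)) - f (inv (?r (c #> g)))) \<le> e"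
      using unif[of u "inv v"] by (simp add: nv_diff_commute)
  qed
  finally show ?thesis .
qed

end

text \<open>Functionals with the required bound are points of a product of compact balls, and the
  properties of an invariant mean are closed conditions there. Any finitely many of them, with
  invariance relaxed to an error, hold for a single Riemann sum.\<close>

theorem invariant_mean_exists:
  assumes ell: "locally_elliptic G T" and free: "n_free G T (p ^ Suc k)"
  shows "\<exists>m. normed_mean G T nv m \<and> left_invariant G T nv m
    \<and> (\<forall>f\<in>CB. nv (m f) \<le> real p ^ k * norm_sup f)"
proof -
  define P where "P = product_topology (\<lambda>f. subtopology (nv_topology nv) {x. nv x \<le> real p ^ k * norm_sup f}) CB"
  have "compact_space P"
    unfolding P_def compact_space_product_topology
    by (intro disjI2 ballI compact_space_subtopology compactin_cball)
  have proj: "continuous_map P (nv_topology nv) (\<lambda>m. m f)" if "f \<in> CB" for f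
    using continuous_map_product_projection[OF that] unfolding P_def
    by (rule continuous_map_into_fulltopology)
  note cont = continuous_map_nv_diff continuous_map_nv_cmult proj Cb_add Cb_cmult Cb_translate
  \<comment> \<open>\<open>D\<close> contains the conditions that every Riemann sum fulfils exactly:
    normalization and linearity.\<close>
  define D where "D = {m \<in> topspace P. nv (m (one_G G) - 1) \<le> 0}
    \<inter> (\<Inter>f\<in>CB. \<Inter>h\<in>CB. {m \<in> topspace P. nv (m (\<lambda>x. f x + h x) - m f - m h) \<le> 0})
    \<inter> (\<Inter>f\<in>CB. \<Inter>c. {m \<in> topspace P. nv (m (\<lambda>x. c * f x) - c * m f) \<le> 0})"
  have CB_ne: "CB \<noteq> {}" using Cb_zero by blast
  have D_closed: "closedin P D"
    unfolding D_def
    by (intro closedin_Int closedin_INT CB_ne closedin_nv_le cont one_G_Cb) auto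
  \<comment> \<open>Riemann sums are invariant only up to an error, so each index carries a
    tolerance \<open>e\<close>; exact invariance returns by intersecting over all
    \<open>e > 0\<close>.\<close>
  define Q where "Q = (\<lambda>(g, f, e). D \<inter> {m \<in> topspace P. nv (m (translate G g f) - m f) \<le> e})"
  define I where "I = carrier G \<times> CB \<times> {0::real<..}"
  have "topspace P \<inter> (\<Inter>i\<in>I. Q i) \<noteq> {}"
  proof (rule compact_space_indexed_fip[OF \<open>compact_space P\<close>])
    show "closedin P (Q i)" if "i \<in> I" for i
      using that unfolding Q_def I_def
      by (auto intro!: closedin_Int D_closed closedin_nv_le cont)
    fix A assume A: "finite A" "A \<subseteq> I"
    have "finite (fst ` A)" "fst ` A \<subseteq> carrier G" using A by (auto simp: I_def)
    then obtain K where K: "subgroup K G" "compactin T K" "fst ` A \<subseteq> K"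
      using ell unfolding locally_elliptic_def by blast
    obtain U where U: "open_subgroup G T U" "compactin T U" "K \<subseteq> U"
      using compact_subgroup_in_compact_open[OF K(1,2)] .
    have pk: "real p ^ k > 0" using p_gt_1 by simp
    \<comment> \<open>The accuracy \<open>e / p ^ k\<close> compensates for the norm
      \<open>p ^ k\<close> of the averages.\<close>
    have "\<exists>V. open_subgroup G T V
        \<and> (\<forall>u\<in>U. \<forall>v\<in>V. nv (fst (snd i) (u \<otimes> v) - fst (snd i) u) < snd (snd i) / real p ^ k)"
      if i: "i \<in> A" for i
    proof -
      have "fst (snd i) \<in> CB" "snd (snd i) / real p ^ k > 0"
        using A(2) i pk by (auto simp: I_def)
      then show ?thesis using uniformly_continuous_on_compact[OF _ U(2)] by metis
    qed
    then obtain W where W: "\<And>i. i \<in> A \<Longrightarrow> open_subgroup G T (W i)"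
      and Wf: "\<And>i u v. i \<in> A \<Longrightarrow> u \<in> U \<Longrightarrow> v \<in> W i \<Longrightarrow>
        nv (fst (snd i) (u \<otimes> v) - fst (snd i) u) < snd (snd i) / real p ^ k"
      by metis
    define V where "V = U \<inter> (\<Inter>i\<in>A. W i)"
    have V: "open_subgroup G T V" "V \<subseteq> U"
      unfolding V_def using A(1) U(1) W by (auto intro: open_subgroup_Int_finite)
    note R = U(1,2) V free
    define m where "m = restrict (riemann_sum U V) CB"
    have m: "m f = riemann_sum U V f" if "f \<in> CB" for f using that by (simp add: m_def)
    have mP: "m \<in> topspace P"
      unfolding P_def m_def using riemann_sum_bound[OF R] by auto
    have "m \<in> D"
      unfolding D_def using mP
      by (auto simp: m Cb_add Cb_cmult one_G_Cb riemann_sum_one[OF R] riemann_sum_add[OF R]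
          riemann_sum_cmult[OF R])
    moreover have "nv (m (translate G g f) - m f) \<le> e" if i: "(g, f, e) \<in> A" for g f e
    proof -
      have gfe: "g \<in> carrier G" "f \<in> CB" "e > 0" and gU: "g \<in> U"
        using A(2) i K(3) U(3) by (auto simp: I_def image_subset_iff)
      have "nv (riemann_sum U V (translate G g f) - riemann_sum U V f) \<le> real p ^ k * (e / real p ^ k)"
      proof (rule riemann_sum_almost_invariant[OF R gU])
        show "nv (f (u \<otimes> v) - f u) \<le> e / real p ^ k" if "u \<in> U" "v \<in> V" for u v
          using Wf[OF i that(1), of v] that(2) i by (force simp: V_def)
      qed (use gfe pk in simp)
      also have "real p ^ k * (e / real p ^ k) = e" using pk by simp
      finally show ?thesis using gfe by (simp add: m Cb_translate)
    qed
    ultimately show "topspace P \<inter> (\<Inter>i\<in>A. Q i) \<noteq> {}"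
      using mP by (auto simp: Q_def)
  qed
  then obtain m where mP: "m \<in> topspace P" and mQ: "\<And>i. i \<in> I \<Longrightarrow> m \<in> Q i" by blast
  \<comment> \<open>Membership in \<open>D\<close> is read off from \<open>Q\<close> at an arbitrary
    index, so one index has to be exhibited.\<close>
  have "(\<one>, \<lambda>_. 0, 1) \<in> I" using Cb_zero by (simp add: I_def)
  then have mD: "m \<in> D" using mQ by (fastforce simp: Q_def)
  have nv0: "nv x \<le> 0 \<longleftrightarrow> x = 0" for x
    using nv_nonneg[of x] nv_zero_iff[of x] by linarith
  have bound: "nv (m f) \<le> real p ^ k * norm_sup f" if "f \<in> CB" for f
    using mP that by (auto simp: P_def PiE_iff)
  have "normed_mean G T nv m"
    unfolding normed_mean_def
  proof (intro conjI ballI allI)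
    show "m (one_G G) = 1" using mD by (simp add: D_def nv0)
    show "m (\<lambda>x. f x + h x) = m f + m h" if "f \<in> CB" "h \<in> CB" for f h
    proof -
      have "m (\<lambda>x. f x + h x) - m f - m h = 0" using mD that unfolding D_def nv0 by blast
      then show ?thesis by (simp add: algebra_simps)
    qed
    show "m (\<lambda>x. c * f x) = c * m f" if "f \<in> CB" for c f
    proof -
      have "m (\<lambda>x. c * f x) - c * m f = 0" using mD that unfolding D_def nv0 by blast
      then show ?thesis by simp
    qed
    show "\<exists>C\<ge>0. \<forall>f\<in>CB. nv (m f) \<le> C * norm_sup f"
      using bound by (intro exI[of _ "real p ^ k"]) auto
  qed
  moreover have "left_invariant G T nv m"
    unfolding left_invariant_def
  proof (intro ballI)
    fix g f assume g: "g \<in> carrier G" and f: "f \<in> CB"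
    have "nv (m (translate G g f) - m f) \<le> e" if "e > 0" for e
      using mQ[of "(g, f, e)"] g f that by (simp add: Q_def I_def)
    then have "nv (m (translate G g f) - m f) \<le> 0"
      by (meson dense_ge)
    then show "m (translate G g f) = m f" by (simp add: nv0)
  qed
  ultimately show ?thesis using bound by blast
qed

section \<open>The norm of the group\<close>

lemma mean_bound_ex:
  assumes "normed_mean G T nv m"
  obtains C where "C \<ge> 0" "\<forall>f\<in>CB. nv (m f) \<le> C * norm_sup f"
  using assms unfolding normed_mean_def by blast

text \<open>These are the exponents at which freeness fails. They form an initial segment of the
  naturals containing 0, which is finite when \<open>pN_free\<close> holds; its maximum is then the
  exponent of the norm in the amenable case.\<close>

definition index_exponents :: "nat set" where
  "index_exponents = {k. \<exists>U V. open_subgroup G T U \<and> open_subgroup G T V \<and> V \<subseteq> U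
     \<and> finite (cosets_in G U V) \<and> p ^ k dvd index G U V}"

lemma n_free_iff: "n_free G T (p ^ k) \<longleftrightarrow> k \<notin> index_exponents"
  by (auto simp: n_free_def index_exponents_def)

lemma index_exponents_mono: "k \<in> index_exponents \<Longrightarrow> j \<le> k \<Longrightarrow> j \<in> index_exponents"
  unfolding index_exponents_def using le_imp_power_dvd[of j k p] dvd_trans by blast

lemma zero_in_index_exponents: "0 \<in> index_exponents"
proof -
  have "cosets_in G (carrier G) (carrier G) \<subseteq> {carrier G}"
    using coset_join2[OF _ subgroup_self] by (auto simp: cosets_in_def)
  then have "finite (cosets_in G (carrier G) (carrier G))"
    by (rule finite_subset) simp
  then show ?thesis unfolding index_exponents_def using open_subgroup_carrier by auto
qed

lemma mean_bound_ge_exponent: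
  assumes "normed_mean G T nv m" "left_invariant G T nv m"
    and "\<forall>f\<in>CB. nv (m f) \<le> C * norm_sup f" and "k \<in> index_exponents"
  shows "real p ^ k \<le> C"
proof -
  obtain U V where "open_subgroup G T U" "open_subgroup G T V" "V \<subseteq> U"
    "finite (cosets_in G U V)" "p ^ k dvd index G U V"
    using assms(4) unfolding index_exponents_def by blast
  then show ?thesis using mean_bound_ge_index[OF assms(1,2)] assms(3) by blast
qed

lemma amenable_imp_pN_free:
  assumes "normed_padic_amenable G T nv"
  shows "pN_free G T p"
proof -
  obtain m where m: "normed_mean G T nv m" "left_invariant G T nv m"
    using assms unfolding normed_padic_amenable_def by blast
  obtain C where C: "C \<ge> 0" "\<forall>f\<in>CB. nv (m f) \<le> C * norm_sup f"
    using mean_bound_ex[OF m(1)] .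
  obtain k where k: "C < real p ^ k" using p_gt_1(1) real_arch_pow by blast
  have "k \<notin> index_exponents" using mean_bound_ge_exponent[OF m C(2)] k by force
  \<comment> \<open>The passage to \<open>Suc k\<close> secures the exponent at least 1 that
    \<open>pN_free\<close> asks for.\<close>
  then have "Suc k \<notin> index_exponents" using index_exponents_mono by (meson le_SucI le_refl)
  then show ?thesis
    unfolding pN_free_def by (intro exI[of _ "Suc k"]) (simp add: n_free_iff del: power_Suc)
qed

lemma amenable_imp_locally_elliptic:
  assumes "normed_padic_amenable G T nv"
  shows "locally_elliptic G T"
proof -
  obtain m where m: "normed_mean G T nv m" "left_invariant G T nv m"
    using assms unfolding normed_padic_amenable_def by blast
  obtain C where "C \<ge> 0" "\<forall>f\<in>CB. nv (m f) \<le> C * norm_sup f"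
    using mean_bound_ex[OF m(1)] .
  then show ?thesis using mean_imp_locally_elliptic[OF m] by blast
qed

lemma finite_index_exponents: "pN_free G T p \<Longrightarrow> finite index_exponents"
proof -
  assume "pN_free G T p"
  then obtain k where "k \<notin> index_exponents" by (auto simp: pN_free_def n_free_iff)
  then have "index_exponents \<subseteq> {..<k}" using index_exponents_mono by (auto simp: not_less[symmetric])
  then show ?thesis using finite_subset by blast
qed

text \<open>This reconciles the minimum and the maximum in the norm formula: the shift by one turns
  the first exponent at which freeness holds into the last one at which it fails.\<close>

lemma n_free_Suc_Max:
  assumes "finite index_exponents"
  shows "n_free G T (p ^ Suc k) \<longleftrightarrow> Max index_exponents \<le> k"
proof -
  have "Max index_exponents \<in> index_exponents"
    using assms zero_in_index_exponents by (intro Max_in) auto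
  then have "Suc k \<in> index_exponents" if "\<not> Max index_exponents \<le> k"
    using that index_exponents_mono by (meson Suc_leI not_le)
  moreover have "Suc k \<notin> index_exponents" if "Max index_exponents \<le> k"
    using that Max_ge[OF assms, of "Suc k"] by linarith
  ultimately show ?thesis unfolding n_free_iff by blast
qed

lemma amenable_if_elliptic_free:
  assumes "locally_elliptic G T" "pN_free G T p"
  shows "normed_padic_amenable G T nv"
  using invariant_mean_exists[OF assms(1)] n_free_Suc_Max[OF finite_index_exponents[OF assms(2)]]
  unfolding normed_padic_amenable_def by blast

text \<open>Every invariant mean has operator norm at least \<open>p ^ Max index_exponents\<close>
  by the index estimate, and the mean built from Riemann sums attains this value, so the infimum is
  a minimum.\<close>

lemma padic_norm_group_eq:
  assumes am: "normed_padic_amenable G T nv"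
  shows "padic_norm_group G T nv = ereal (real p ^ Max index_exponents)"
proof -
  let ?M = "real p ^ Max index_exponents"
  have fin: "finite index_exponents"
    using finite_index_exponents amenable_imp_pN_free am by blast
  obtain m where m: "normed_mean G T nv m" "left_invariant G T nv m"
    "\<forall>f\<in>CB. nv (m f) \<le> ?M * norm_sup f"
    using invariant_mean_exists[OF amenable_imp_locally_elliptic[OF am]] n_free_Suc_Max[OF fin] by blast
  have lower: "?M \<le> op_norm G T nv m'" if m': "normed_mean G T nv m'" "left_invariant G T nv m'" for m'
    unfolding op_norm_def
  proof (rule cInf_greatest)
    obtain C where "C \<ge> 0" "\<forall>f\<in>CB. nv (m' f) \<le> C * norm_sup f"
      using mean_bound_ex[OF m'(1)] .
    then show "{C. C \<ge> 0 \<and> (\<forall>f\<in>CB. nv (m' f) \<le> C * norm_sup f)} \<noteq> {}" by blast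
    have "Max index_exponents \<in> index_exponents"
      using fin zero_in_index_exponents by (intro Max_in) auto
    then show "?M \<le> C" if "C \<in> {C. C \<ge> 0 \<and> (\<forall>f\<in>CB. nv (m' f) \<le> C * norm_sup f)}" for C
      using mean_bound_ge_exponent[OF m'] that by blast
  qed
  moreover have "op_norm G T nv m \<le> ?M"
    unfolding op_norm_def using m(3) by (intro cInf_lower bdd_belowI[of _ 0]) auto
  ultimately have M: "?M = op_norm G T nv m" using m by (simp add: order_antisym)
  have "Inf {op_norm G T nv m | m. normed_mean G T nv m \<and> left_invariant G T nv m} = ?M"
  proof (rule cInf_eq_minimum)
    show "?M \<in> {op_norm G T nv m | m. normed_mean G T nv m \<and> left_invariant G T nv m}"
      using M m(1,2) by blast
  qed (use lower in blast)
  then show ?thesis using am by (simp add: padic_norm_group_def)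
qed

end

theorem theorem1p9:
  fixes p :: nat and G :: "('g, 'b) monoid_scheme" and T :: "'g topology"
    and nv :: "'k::field_char_0 \<Rightarrow> real"
  assumes "Factorial_Ring.prime p"
    and "is_Qp p nv"
    and "tdlc_group G T"
  shows "(normed_padic_amenable G T nv \<longleftrightarrow> locally_elliptic G T \<and> pN_free G T p)
    \<and> (normed_padic_amenable G T nv \<longrightarrow>
         padic_norm_group G T nv = ereal (real (Inf {p ^ k | k. n_free G T (p ^ (k + 1))}))
       \<and> finite {p ^ k | k. \<exists>U V. open_subgroup G T U \<and> open_subgroup G T V \<and> V \<subseteq> U
                       \<and> finite (cosets_in G U V) \<and> p ^ k dvd index G U V}
       \<and> padic_norm_group G T nv = ereal (real (Max {p ^ k | k. \<exists>U V. open_subgroup G T U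
                       \<and> open_subgroup G T V \<and> V \<subseteq> U
                       \<and> finite (cosets_in G U V) \<and> p ^ k dvd index G U V})))"
proof -
  interpret Qp_tdlc p nv G T
    by unfold_locales (use assms in auto)
  let ?S = "{p ^ k | k. \<exists>U V. open_subgroup G T U \<and> open_subgroup G T V \<and> V \<subseteq> U
    \<and> finite (cosets_in G U V) \<and> p ^ k dvd index G U V}"
  let ?K = "Max index_exponents"
  have S: "?S = (\<lambda>k. p ^ k) ` index_exponents"
    by (auto simp: index_exponents_def)
  have mono: "p ^ j \<le> p ^ k" if "j \<le> k" for j k
    using that p_gt_1(2) by (intro power_increasing) auto
  have "padic_norm_group G T nv = ereal (real (Inf {p ^ k | k. n_free G T (p ^ (k + 1))}))
      \<and> finite ?S \<and> padic_norm_group G T nv = ereal (real (Max ?S))"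
    if am: "normed_padic_amenable G T nv"
  proof -
    have fin: "finite index_exponents"
      using finite_index_exponents amenable_imp_pN_free am by blast
    have "Inf {p ^ k | k. n_free G T (p ^ (k + 1))} = p ^ ?K"
      using n_free_Suc_Max[OF fin] mono by (intro cInf_eq_minimum) auto
    moreover have "?K \<in> index_exponents"
      using fin zero_in_index_exponents by (intro Max_in) auto
    then have "Max ?S = p ^ ?K"
      unfolding S using fin Max_ge[OF fin] mono by (intro Max_eqI) auto
    moreover have "finite ?S" unfolding S using fin by blast
    ultimately show ?thesis using padic_norm_group_eq[OF am] by simp
  qed
  then show ?thesis
    using amenable_imp_locally_elliptic amenable_imp_pN_free amenable_if_elliptic_free by blast
qed

end
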